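(* Suppose $W=\sum_{i=1}^n\gamma_ix^{v_i}$ is a positive Laurent polynomial on the torus $T$ over $\mathbf K$. Then $W$ has a unique positive critical point (i.e. exactly one critical point in $T(\mathbf K_{>0})$) if and only if the Newton polytope of $W$ is full-dimensional with $0$ in the interior.
   Context: $\mathbf K$ is the field of generalised Puiseux series $c(t)=\sum_kc_{\mu_k}t^{\mu_k}$, $c_{\mu_k}\in\mathbb C$, with real exponents forming a strictly increasing sequence that is finite or tends to $+\infty$; $\mathbf K_{>0}$ is the set of nonzero series whose leading coefficient is in $\mathbb R_{>0}$. $T$ is a split torus over $\mathbf K$ of dimension $r\ge1$ with character lattice $M\cong\mathbb Z^r$ and cocharacter lattice $N$, dual pairing $\langle\ ,\ \rangle$, $M_{\mathbb R}=M\otimes\mathbb R$; $T(\mathbf K_{>0})=\operatorname{Hom}(M,\mathbf K_{>0})\cong(\mathbf K_{>0})^r$, and $p^v$ is the value of $p$ on $v\in M$. A positive Laurent polynomial is $W=\sum_{i=1}^n\gamma_ix^{v_i}$ with $\gamma_i\in\mathbf K_{>0}$ and distinct $v_i\in M$; its Newton polytope is $\operatorname{ConvexHull}(\{v_1,\dots,v_n\})\subset M_{\mathbb R}$. A point $p$ is a critical point of $W$ if $\sum_i\gamma_i\langle v_i,u\rangle p^{v_i}=0$ for all $u\in N$ (equivalently, all partial derivatives with respect to torus coordinates vanish at $p$). *)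

theory Defs
  imports "HOL-Analysis.Analysis" "HOL-Library.Poly_Mapping"
begin

section \<open>Generalised Puiseux series\<close>

definition puiseux_exponents :: "real set \<Rightarrow> bool" where
  "puiseux_exponents S \<longleftrightarrow>
     finite S \<or> (\<exists>\<mu> :: nat \<Rightarrow> real. strict_mono \<mu> \<and> filterlim \<mu> at_top sequentially \<and> S = range \<mu>)"

lemma puiseux_exponents_iff: "puiseux_exponents S \<longleftrightarrow> (\<forall>a. finite (S \<inter> {..a}))"
proof
  assume S: "puiseux_exponents S"
  show "\<forall>a. finite (S \<inter> {..a})"
  proof (cases "finite S")
    case False
    then obtain \<mu> :: "nat \<Rightarrow> real"
      where lim: "filterlim \<mu> at_top sequentially" and S_eq: "S = range \<mu>"
      using S by (auto simp: puiseux_exponents_def)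
    show ?thesis
    proof
      fix a
      have "eventually (\<lambda>n. a < \<mu> n) sequentially"
        using lim by (simp add: filterlim_at_top_dense)
      then obtain N where N: "\<And>n. n \<ge> N \<Longrightarrow> a < \<mu> n"
        by (auto simp: eventually_sequentially)
      have "S \<inter> {..a} \<subseteq> \<mu> ` {..<N}"
      proof
        fix x assume "x \<in> S \<inter> {..a}"
        then obtain n where n: "x = \<mu> n" "\<mu> n \<le> a" by (auto simp: S_eq)
        then have "n < N" using N[of n] by (meson leD leI)
        then show "x \<in> \<mu> ` {..<N}" using n by auto
      qed
      then show "finite (S \<inter> {..a})"
        by (rule finite_subset) simp
    qed
  qed simp
next
  assume fin: "\<forall>a. finite (S \<inter> {..a})"
  show "puiseux_exponents S"
  proof (cases "finite S")
    case False
    define f where "f x = card {y \<in> S. y < x}" for x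
    have fin': "finite {y \<in> S. y < x}" for x
      by (rule finite_subset[OF _ fin[rule_format, of x]]) auto
    have mono: "f x < f y" if "x \<in> S" "x < y" for x y
      unfolding f_def using that by (intro psubset_card_mono fin') force+
    have inj: "inj_on f S"
    proof (rule inj_onI)
      fix x y assume *: "x \<in> S" "y \<in> S" "f x = f y"
      then show "x = y" using mono[of x y] mono[of y x] by (cases x y rule: linorder_cases) auto
    qed
    have below: "f ` {y \<in> S. y < x} = {..<f x}" for x
    proof (rule card_subset_eq)
      show "f ` {y \<in> S. y < x} \<subseteq> {..<f x}" using mono by auto
      have "inj_on f {y \<in> S. y < x}" by (rule inj_on_subset[OF inj]) auto
      then show "card (f ` {y \<in> S. y < x}) = card {..<f x}"
        by (simp add: card_image) (simp add: f_def)
    qed simp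
    have surj: "f ` S = UNIV"
    proof -
      have "infinite (f ` S)" using False inj finite_imageD by blast
      have "n \<in> f ` S" for n
      proof -
        obtain m where "m > n" "m \<in> f ` S"
          using \<open>infinite (f ` S)\<close> by (meson infinite_nat_iff_unbounded)
        then obtain x where "x \<in> S" "n \<in> {..<f x}" by auto
        then show ?thesis using below[of x] by auto
      qed
      then show ?thesis by auto
    qed
    define \<mu> where "\<mu> = inv_into S f"
    have \<mu>S: "\<mu> n \<in> S" and f\<mu>: "f (\<mu> n) = n" for n
      unfolding \<mu>_def using surj by (auto intro: inv_into_into f_inv_into_f)
    have \<mu>f: "\<mu> (f x) = x" if "x \<in> S" for x
      unfolding \<mu>_def using inj that by simp
    have "strict_mono \<mu>"
    proof (rule strict_monoI)
      fix m n :: nat assume "m < n"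
      then show "\<mu> m < \<mu> n"
        using mono[of "\<mu> n" "\<mu> m"] \<mu>S f\<mu> by (metis linorder_neqE not_less_iff_gr_or_eq)
    qed
    moreover have "filterlim \<mu> at_top sequentially"
    proof (subst filterlim_at_top, intro allI)
      fix a
      obtain N where N: "\<forall>n \<in> f ` (S \<inter> {..a}). n \<le> N"
        using fin finite_nat_set_iff_bounded_le by blast
      show "eventually (\<lambda>n. a \<le> \<mu> n) sequentially"
        unfolding eventually_sequentially
      proof (intro exI allI impI)
        fix n assume "Suc N \<le> n"
        show "a \<le> \<mu> n"
        proof (rule ccontr)
          assume "\<not> a \<le> \<mu> n"
          then have "\<mu> n \<in> S \<inter> {..a}" using \<mu>S by auto
          then have "f (\<mu> n) \<le> N" using N by blast
          then show False using f\<mu> \<open>Suc N \<le> n\<close> by simp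
        qed
      qed
    qed
    moreover have "S = range \<mu>"
      using \<mu>S \<mu>f by (auto intro: range_eqI[of _ _ "f _"]) (metis rangeI)
    ultimately show ?thesis by (auto simp: puiseux_exponents_def)
  qed (simp add: puiseux_exponents_def)
qed

text \<open>A series is given by its coefficient function; its support is the set of exponents.\<close>

typedef puiseux = "{c :: real \<Rightarrow> complex. puiseux_exponents {\<mu>. c \<mu> \<noteq> 0}}"
  morphisms pcoeff Abs_puiseux
  by (rule exI[of _ "\<lambda>_. 0"]) (simp add: puiseux_exponents_def)

abbreviation supp :: "puiseux \<Rightarrow> real set" where
  "supp x \<equiv> {\<mu>. pcoeff x \<mu> \<noteq> 0}"

lemma puiseux_eqI: "(\<And>e. pcoeff x e = pcoeff y e) \<Longrightarrow> x = y"
  by (simp add: pcoeff_inject[symmetric] fun_eq_iff)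

lemma finite_supp: "finite (supp x \<inter> {..a})"
  using pcoeff[of x] by (simp add: puiseux_exponents_iff)

lemma supp_bounded_below: obtains m where "\<And>a. pcoeff x a \<noteq> 0 \<Longrightarrow> m \<le> a"
proof -
  have "bdd_below (supp x \<inter> {..0})"
    by (rule bdd_below_finite[OF finite_supp])
  then obtain m where m: "\<And>a. a \<in> supp x \<inter> {..0} \<Longrightarrow> m \<le> a"
    by (auto simp: bdd_below_def)
  show ?thesis
  proof
    show "min m 0 \<le> a" if "pcoeff x a \<noteq> 0" for a
      using m[of a] that by (cases "a \<le> 0") auto
  qed
qed

lemma pcoeff_Abs_puiseux:
  assumes "\<And>a. finite ({\<mu>. c \<mu> \<noteq> 0} \<inter> {..a})"
  shows "pcoeff (Abs_puiseux c) = c"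
  using assms by (intro Abs_puiseux_inverse) (simp add: puiseux_exponents_iff)

instantiation puiseux :: comm_ring_1
begin

definition "0 = Abs_puiseux (\<lambda>_. 0)"
definition "1 = Abs_puiseux (\<lambda>e. if e = 0 then 1 else 0)"
definition "x + y = Abs_puiseux (\<lambda>e. pcoeff x e + pcoeff y e)"
definition "x - y = Abs_puiseux (\<lambda>e. pcoeff x e - pcoeff y e)"
definition "- x = Abs_puiseux (\<lambda>e. - pcoeff x e)"
definition "x * y = Abs_puiseux (\<lambda>e.
  \<Sum>a | pcoeff x a \<noteq> 0 \<and> pcoeff y (e - a) \<noteq> 0. pcoeff x a * pcoeff y (e - a))"

lemma pcoeff_zero [simp]: "pcoeff 0 e = 0"
  unfolding zero_puiseux_def by (subst pcoeff_Abs_puiseux) auto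

lemma pcoeff_one: "pcoeff 1 e = (if e = 0 then 1 else 0)"
proof -
  have "finite ({\<mu>::real. (if \<mu> = 0 then 1 else 0 :: complex) \<noteq> 0} \<inter> {..a})" for a
    by (rule finite_subset[of _ "{0}"]) (auto split: if_splits)
  then show ?thesis unfolding one_puiseux_def by (subst pcoeff_Abs_puiseux) auto
qed

lemma pcoeff_add [simp]: "pcoeff (x + y) e = pcoeff x e + pcoeff y e"
proof -
  have "finite ({\<mu>. pcoeff x \<mu> + pcoeff y \<mu> \<noteq> 0} \<inter> {..a})" for a
    by (rule finite_subset[OF _ finite_UnI[OF finite_supp[of x a] finite_supp[of y a]]]) auto
  then show ?thesis unfolding plus_puiseux_def by (subst pcoeff_Abs_puiseux) auto
qed

lemma pcoeff_diff [simp]: "pcoeff (x - y) e = pcoeff x e - pcoeff y e"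
proof -
  have "finite ({\<mu>. pcoeff x \<mu> - pcoeff y \<mu> \<noteq> 0} \<inter> {..a})" for a
    by (rule finite_subset[OF _ finite_UnI[OF finite_supp[of x a] finite_supp[of y a]]]) auto
  then show ?thesis unfolding minus_puiseux_def by (subst pcoeff_Abs_puiseux) auto
qed

lemma pcoeff_uminus [simp]: "pcoeff (- x) e = - pcoeff x e"
  using finite_supp[of x] unfolding uminus_puiseux_def by (subst pcoeff_Abs_puiseux) auto

lemma pcoeff_mult_aux:
  "pcoeff (x * y) e = (\<Sum>a | pcoeff x a \<noteq> 0 \<and> pcoeff y (e - a) \<noteq> 0. pcoeff x a * pcoeff y (e - a))"
proof -
  define c where "c e = (\<Sum>a | pcoeff x a \<noteq> 0 \<and> pcoeff y (e - a) \<noteq> 0. pcoeff x a * pcoeff y (e - a))" for e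
  obtain m where m: "\<And>a. pcoeff x a \<noteq> 0 \<Longrightarrow> m \<le> a" using supp_bounded_below[of x] by metis
  obtain n where n: "\<And>a. pcoeff y a \<noteq> 0 \<Longrightarrow> n \<le> a" using supp_bounded_below[of y] by metis
  have "finite ({e. c e \<noteq> 0} \<inter> {..b})" for b
  proof (rule finite_subset)
    show "{e. c e \<noteq> 0} \<inter> {..b} \<subseteq>
      (\<lambda>(a, a'). a + a') ` ((supp x \<inter> {..b - n}) \<times> (supp y \<inter> {..b - m}))"
    proof
      fix e assume "e \<in> {e. c e \<noteq> 0} \<inter> {..b}"
      then have "c e \<noteq> 0" "e \<le> b" by auto
      have "{a. pcoeff x a \<noteq> 0 \<and> pcoeff y (e - a) \<noteq> 0} \<noteq> {}"
        using \<open>c e \<noteq> 0\<close> unfolding c_def by (metis sum.empty)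
      then obtain a where a: "pcoeff x a \<noteq> 0" "pcoeff y (e - a) \<noteq> 0" by auto
      then show "e \<in> (\<lambda>(a, a'). a + a') ` ((supp x \<inter> {..b - n}) \<times> (supp y \<inter> {..b - m}))"
        using m[of a] n[of "e - a"] \<open>e \<le> b\<close>
        by (intro image_eqI[of _ _ "(a, e - a)"]) auto
    qed
  qed (use finite_supp in blast)
  then have "pcoeff (Abs_puiseux c) = c" by (rule pcoeff_Abs_puiseux)
  then show ?thesis by (simp add: times_puiseux_def c_def[abs_def])
qed

lemma pcoeff_mult:
  assumes "finite A" "finite B"
    and "\<And>a b. pcoeff x a \<noteq> 0 \<Longrightarrow> pcoeff y b \<noteq> 0 \<Longrightarrow> a + b = e \<Longrightarrow> a \<in> A \<and> b \<in> B"
  shows "pcoeff (x * y) e = (\<Sum>a\<in>A. \<Sum>b\<in>B. if a + b = e then pcoeff x a * pcoeff y b else 0)"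
proof -
  let ?S = "{a. pcoeff x a \<noteq> 0 \<and> pcoeff y (e - a) \<noteq> 0}"
  have "(\<Sum>a\<in>A. \<Sum>b\<in>B. if a + b = e then pcoeff x a * pcoeff y b else 0) =
        (\<Sum>a\<in>A. \<Sum>b\<in>B. if b = e - a then pcoeff x a * pcoeff y (e - a) else 0)"
    by (intro sum.cong refl) auto
  also have "\<dots> = (\<Sum>a\<in>A. if e - a \<in> B then pcoeff x a * pcoeff y (e - a) else 0)"
    using assms(2) by simp
  also have "\<dots> = (\<Sum>a\<in>?S. pcoeff x a * pcoeff y (e - a))"
  proof (rule sum.mono_neutral_cong_right[OF assms(1)])
    show "?S \<subseteq> A" using assms(3) by force
    show "\<forall>a\<in>A - ?S. (if e - a \<in> B then pcoeff x a * pcoeff y (e - a) else 0) = 0" by auto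
    show "(if e - a \<in> B then pcoeff x a * pcoeff y (e - a) else 0) = pcoeff x a * pcoeff y (e - a)"
      if "a \<in> ?S" for a using assms(3)[of a "e - a"] that by auto
  qed
  finally show ?thesis by (simp add: pcoeff_mult_aux)
qed

lemma pcoeff_mult_nonzero:
  assumes "pcoeff (x * y) e \<noteq> 0"
  obtains a b where "pcoeff x a \<noteq> 0" "pcoeff y b \<noteq> 0" "a + b = e"
proof -
  have "{a. pcoeff x a \<noteq> 0 \<and> pcoeff y (e - a) \<noteq> 0} \<noteq> {}"
    using assms unfolding pcoeff_mult_aux by (metis sum.empty)
  then show ?thesis using that by force
qed

lemma sum_delta_plus:
  fixes F :: "real \<Rightarrow> complex"
  assumes "finite D" "s \<in> D"
  shows "(\<Sum>d\<in>D. if s = d then F d else 0) = F s"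
  using assms by simp

lemma sum_rotate3:
  "(\<Sum>c\<in>C. \<Sum>a\<in>A. \<Sum>b\<in>B. F a b c) = (\<Sum>a\<in>A. \<Sum>b\<in>B. \<Sum>c\<in>C. F a b c :: complex)"
  by (rule trans[OF sum.swap], intro sum.cong refl, rule sum.swap)

lemma sum_rotate4:
  "(\<Sum>d\<in>D. \<Sum>c\<in>C. \<Sum>a\<in>A. \<Sum>b\<in>B. F a b c d) =
   (\<Sum>a\<in>A. \<Sum>b\<in>B. \<Sum>c\<in>C. \<Sum>d\<in>D. F a b c d :: complex)"
proof -
  have "(\<Sum>d\<in>D. \<Sum>c\<in>C. \<Sum>a\<in>A. \<Sum>b\<in>B. F a b c d) =
        (\<Sum>d\<in>D. \<Sum>a\<in>A. \<Sum>b\<in>B. \<Sum>c\<in>C. F a b c d)"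
    by (intro sum.cong refl, rule sum_rotate3)
  also have "\<dots> = (\<Sum>a\<in>A. \<Sum>b\<in>B. \<Sum>d\<in>D. \<Sum>c\<in>C. F a b c d)"
    by (rule sum_rotate3)
  also have "\<dots> = (\<Sum>a\<in>A. \<Sum>b\<in>B. \<Sum>c\<in>C. \<Sum>d\<in>D. F a b c d)"
    by (intro sum.cong refl, rule sum.swap)
  finally show ?thesis .
qed

lemma pcoeff_mult3:
  assumes "\<And>a. pcoeff x a \<noteq> 0 \<Longrightarrow> l \<le> a" "\<And>a. pcoeff y a \<noteq> 0 \<Longrightarrow> m \<le> a"
    "\<And>a. pcoeff z a \<noteq> 0 \<Longrightarrow> n \<le> a"
  shows "pcoeff (x * y * z) e =
    (\<Sum>a\<in>supp x \<inter> {..e - m - n}. \<Sum>b\<in>supp y \<inter> {..e - l - n}. \<Sum>c\<in>supp z \<inter> {..e - l - m}.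
       if a + b + c = e then pcoeff x a * pcoeff y b * pcoeff z c else 0)"
proof -
  let ?A = "supp x \<inter> {..e - m - n}" and ?B = "supp y \<inter> {..e - l - n}"
  let ?C = "supp z \<inter> {..e - l - m}"
  let ?D = "(\<lambda>(a, b). a + b) ` (?A \<times> ?B)"
  have finD: "finite ?D" by (intro finite_imageI finite_cartesian_product finite_supp)
  have dec: "pcoeff (x * y) d = (\<Sum>a\<in>?A. \<Sum>b\<in>?B. if a + b = d then pcoeff x a * pcoeff y b else 0)"
    if "d \<le> e - n" for d
  proof (rule pcoeff_mult[OF finite_supp finite_supp])
    fix a b assume "pcoeff x a \<noteq> 0" "pcoeff y b \<noteq> 0" "a + b = d"
    then show "a \<in> ?A \<and> b \<in> ?B" using that assms(1)[of a] assms(2)[of b] by auto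
  qed
  have nz: "d \<in> ?D \<and> l + m \<le> d" if d: "d \<le> e - n" "pcoeff (x * y) d \<noteq> 0" for d
  proof -
    have "(\<Sum>a\<in>?A. \<Sum>b\<in>?B. if a + b = d then pcoeff x a * pcoeff y b else 0) \<noteq> 0"
      using d(2) unfolding dec[OF d(1)] .
    then obtain a where a: "a \<in> ?A"
      "(\<Sum>b\<in>?B. if a + b = d then pcoeff x a * pcoeff y b else 0) \<noteq> 0"
      by (rule sum.not_neutral_contains_not_neutral)
    from a(2) obtain b where b: "b \<in> ?B" "(if a + b = d then pcoeff x a * pcoeff y b else 0) \<noteq> 0"
      by (rule sum.not_neutral_contains_not_neutral)
    have "a + b = d" using b(2) by (auto split: if_splits)
    moreover have "l \<le> a" "m \<le> b" using a(1) b(1) assms by auto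
    ultimately show ?thesis
      using a(1) b(1) by (auto intro!: image_eqI[of _ _ "(a, b)"])
  qed
  have lm: "l + m \<le> d" if nz_d: "pcoeff (x * y) d \<noteq> 0" for d
  proof -
    obtain a b where "pcoeff x a \<noteq> 0" "pcoeff y b \<noteq> 0" "a + b = d"
      using nz_d by (rule pcoeff_mult_nonzero)
    then show ?thesis using assms(1)[of a] assms(2)[of b] by simp
  qed
  have "pcoeff (x * y * z) e =
    (\<Sum>d\<in>?D. \<Sum>c\<in>?C. if d + c = e then pcoeff (x * y) d * pcoeff z c else 0)"
  proof (rule pcoeff_mult[OF finD finite_supp])
    fix d c assume dc: "pcoeff (x * y) d \<noteq> 0" "pcoeff z c \<noteq> 0" "d + c = e"
    have "n \<le> c" using assms dc by auto
    then have "d \<le> e - n" using dc(3) by simp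
    then show "d \<in> ?D \<and> c \<in> ?C" using nz[of d] lm[of d] dc by auto
  qed
  also have "\<dots> = (\<Sum>d\<in>?D. \<Sum>c\<in>?C. \<Sum>a\<in>?A. \<Sum>b\<in>?B.
      if a + b = d then if d + c = e then pcoeff x a * pcoeff y b * pcoeff z c else 0 else 0)"
  proof (intro sum.cong refl)
    fix d c assume "d \<in> ?D" "c \<in> ?C"
    show "(if d + c = e then pcoeff (x * y) d * pcoeff z c else 0) = (\<Sum>a\<in>?A. \<Sum>b\<in>?B.
      if a + b = d then if d + c = e then pcoeff x a * pcoeff y b * pcoeff z c else 0 else 0)"
    proof (cases "d + c = e")
      case True
      have "n \<le> c" using assms \<open>c \<in> ?C\<close> by auto
      then have "d \<le> e - n" using True by simp
      then show ?thesis using True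
        by (simp add: dec sum_distrib_right) (intro sum.cong refl, auto)
    next
      case False
      have "(\<Sum>a\<in>?A. \<Sum>b\<in>?B. if a + b = d then
          if d + c = e then pcoeff x a * pcoeff y b * pcoeff z c else 0 else 0) = 0"
        using False by (intro sum.neutral ballI) auto
      then show ?thesis using False by simp
    qed
  qed
  also have "\<dots> = (\<Sum>a\<in>?A. \<Sum>b\<in>?B. \<Sum>c\<in>?C. \<Sum>d\<in>?D.
      if a + b = d then if d + c = e then pcoeff x a * pcoeff y b * pcoeff z c else 0 else 0)"
    by (rule sum_rotate4)
  also have "\<dots> = (\<Sum>a\<in>?A. \<Sum>b\<in>?B. \<Sum>c\<in>?C.
      if a + b + c = e then pcoeff x a * pcoeff y b * pcoeff z c else 0)"
    by (intro sum.cong refl sum_delta_plus finD) auto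
  finally show ?thesis .
qed

instance
proof
  fix x y z :: puiseux
  obtain l where l: "\<And>a. pcoeff x a \<noteq> 0 \<Longrightarrow> l \<le> a" using supp_bounded_below[of x] by metis
  obtain m where m: "\<And>a. pcoeff y a \<noteq> 0 \<Longrightarrow> m \<le> a" using supp_bounded_below[of y] by metis
  obtain n where n: "\<And>a. pcoeff z a \<noteq> 0 \<Longrightarrow> n \<le> a" using supp_bounded_below[of z] by metis
  have comm: "x * y = y * x" for x y :: puiseux
  proof (rule puiseux_eqI)
    fix e
    obtain l where l: "\<And>a. pcoeff x a \<noteq> 0 \<Longrightarrow> l \<le> a" using supp_bounded_below[of x] by metis
    obtain m where m: "\<And>a. pcoeff y a \<noteq> 0 \<Longrightarrow> m \<le> a" using supp_bounded_below[of y] by metis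
    let ?A = "supp x \<inter> {..e - m}" and ?B = "supp y \<inter> {..e - l}"
    have "pcoeff (x * y) e = (\<Sum>a\<in>?A. \<Sum>b\<in>?B. if a + b = e then pcoeff x a * pcoeff y b else 0)"
    proof (rule pcoeff_mult[OF finite_supp finite_supp])
      fix a b assume "pcoeff x a \<noteq> 0" "pcoeff y b \<noteq> 0" "a + b = e"
      then show "a \<in> ?A \<and> b \<in> ?B" using l[of a] m[of b] by auto
    qed
    also have "\<dots> = (\<Sum>b\<in>?B. \<Sum>a\<in>?A. if b + a = e then pcoeff y b * pcoeff x a else 0)"
      by (subst sum.swap, intro sum.cong refl) (auto simp: algebra_simps)
    also have "\<dots> = pcoeff (y * x) e"
    proof (rule pcoeff_mult[OF finite_supp finite_supp, symmetric])
      fix b a assume "pcoeff y b \<noteq> 0" "pcoeff x a \<noteq> 0" "b + a = e"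
      then show "b \<in> ?B \<and> a \<in> ?A" using l[of a] m[of b] by auto
    qed
    finally show "pcoeff (x * y) e = pcoeff (y * x) e" .
  qed
  then show "x * y = y * x" .
  have "x * y * z = y * z * x"
  proof (rule puiseux_eqI)
    fix e
    have "pcoeff (x * y * z) e =
      (\<Sum>a\<in>supp x \<inter> {..e - m - n}. \<Sum>b\<in>supp y \<inter> {..e - l - n}. \<Sum>c\<in>supp z \<inter> {..e - l - m}.
        if a + b + c = e then pcoeff x a * pcoeff y b * pcoeff z c else 0)"
      by (rule pcoeff_mult3[OF l m n])
    also have "\<dots> = (\<Sum>b\<in>supp y \<inter> {..e - l - n}. \<Sum>c\<in>supp z \<inter> {..e - l - m}.
      \<Sum>a\<in>supp x \<inter> {..e - m - n}. if a + b + c = e then pcoeff x a * pcoeff y b * pcoeff z c else 0)"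
      by (rule sum_rotate3)
    also have "\<dots> = (\<Sum>b\<in>supp y \<inter> {..e - n - l}. \<Sum>c\<in>supp z \<inter> {..e - m - l}.
      \<Sum>a\<in>supp x \<inter> {..e - m - n}. if b + c + a = e then pcoeff y b * pcoeff z c * pcoeff x a else 0)"
      by (intro sum.cong refl) (auto simp: algebra_simps)
    also have "\<dots> = pcoeff (y * z * x) e"
      by (rule pcoeff_mult3[OF m n l, symmetric])
    finally show "pcoeff (x * y * z) e = pcoeff (y * z * x) e" .
  qed
  then show "x * y * z = x * (y * z)" by (simp add: comm[of x "y * z"])
  show "(x + y) * z = x * z + y * z"
  proof (rule puiseux_eqI)
    fix e
    let ?A = "supp x \<inter> {..e - n} \<union> supp y \<inter> {..e - n}"
    let ?B = "supp z \<inter> {..e - min l m}"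
    have fin: "finite ?A" "finite ?B" using finite_supp by auto
    have mem: "a \<in> ?A \<and> b \<in> ?B"
      if "pcoeff x a \<noteq> 0 \<or> pcoeff y a \<noteq> 0" "pcoeff z b \<noteq> 0" "a + b = e" for a b
      using that l[of a] m[of a] n[of b] by auto
    have 1: "pcoeff (w * z) e = (\<Sum>a\<in>?A. \<Sum>b\<in>?B. if a + b = e then pcoeff w a * pcoeff z b else 0)"
      if "\<And>a. pcoeff w a \<noteq> 0 \<Longrightarrow> pcoeff x a \<noteq> 0 \<or> pcoeff y a \<noteq> 0" for w
      by (rule pcoeff_mult[OF fin]) (use that mem in blast)
    have "pcoeff ((x + y) * z) e =
      (\<Sum>a\<in>?A. \<Sum>b\<in>?B. if a + b = e then pcoeff (x + y) a * pcoeff z b else 0)"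
      by (rule 1) auto
    also have "\<dots> = (\<Sum>a\<in>?A. \<Sum>b\<in>?B. (if a + b = e then pcoeff x a * pcoeff z b else 0) +
        (if a + b = e then pcoeff y a * pcoeff z b else 0))"
      by (intro sum.cong refl) (auto simp: algebra_simps)
    also have "\<dots> = pcoeff (x * z) e + pcoeff (y * z) e"
      by (subst (1 2) 1) (auto simp only: sum.distrib)
    finally show "pcoeff ((x + y) * z) e = pcoeff (x * z + y * z) e" by simp
  qed
  show "1 * x = x"
  proof (rule puiseux_eqI)
    fix e
    have "pcoeff (1 * x) e = (\<Sum>a\<in>{0}. \<Sum>b\<in>{e}. if a + b = e then pcoeff 1 a * pcoeff x b else 0)"
      by (rule pcoeff_mult) (auto simp: pcoeff_one split: if_splits)
    then show "pcoeff (1 * x) e = pcoeff x e" by (simp add: pcoeff_one)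
  qed
  show "(0 :: puiseux) \<noteq> 1"
    by (metis pcoeff_one pcoeff_zero zero_neq_one)
qed (auto intro!: puiseux_eqI)

end

definition leading_exponent :: "puiseux \<Rightarrow> real" where
  "leading_exponent x = (LEAST \<mu>. pcoeff x \<mu> \<noteq> 0)"

lemma leading_exponent:
  assumes "x \<noteq> 0"
  shows "pcoeff x (leading_exponent x) \<noteq> 0"
    and "\<And>\<mu>. pcoeff x \<mu> \<noteq> 0 \<Longrightarrow> leading_exponent x \<le> \<mu>"
proof -
  obtain a where a: "pcoeff x a \<noteq> 0" using assms puiseux_eqI[of x 0] by auto
  define m where "m = Min (supp x \<inter> {..a})"
  have ne: "supp x \<inter> {..a} \<noteq> {}" using a by auto
  have m: "pcoeff x m \<noteq> 0" "m \<le> a" using Min_in[OF finite_supp ne] by (auto simp: m_def)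
  have le: "m \<le> \<mu>" if "pcoeff x \<mu> \<noteq> 0" for \<mu>
    using Min_le[OF finite_supp[of x a], of \<mu>] that m(2) by (cases "\<mu> \<le> a") (auto simp: m_def)
  have "leading_exponent x = m"
    unfolding leading_exponent_def using m(1) le by (intro Least_equality) auto
  then show "pcoeff x (leading_exponent x) \<noteq> 0"
    and "\<And>\<mu>. pcoeff x \<mu> \<noteq> 0 \<Longrightarrow> leading_exponent x \<le> \<mu>"
    using m(1) le by auto
qed

definition monomial :: "complex \<Rightarrow> real \<Rightarrow> puiseux" where
  "monomial c m = Abs_puiseux (\<lambda>e. if e = m then c else 0)"

lemma pcoeff_monomial: "pcoeff (monomial c m) e = (if e = m then c else 0)"
proof -
  have "finite ({\<mu>. (if \<mu> = m then c else 0) \<noteq> 0} \<inter> {..a})" for a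
    by (rule finite_subset[of _ "{m}"]) (auto split: if_splits)
  then show ?thesis unfolding monomial_def by (subst pcoeff_Abs_puiseux) auto
qed

lemma pcoeff_monomial_mult: "pcoeff (monomial c m * x) e = c * pcoeff x (e - m)"
proof -
  have "pcoeff (monomial c m * x) e =
    (\<Sum>a\<in>{m}. \<Sum>b\<in>{e - m}. if a + b = e then pcoeff (monomial c m) a * pcoeff x b else 0)"
    by (rule pcoeff_mult) (auto simp: pcoeff_monomial split: if_splits)
  then show ?thesis by (simp add: pcoeff_monomial)
qed

lemma one_minus_invertible:
  assumes "\<epsilon> > 0" and z: "\<And>e. pcoeff z e \<noteq> 0 \<Longrightarrow> \<epsilon> \<le> e"
  shows "\<exists>y. (1 - z) * y = 1"
proof -
  define N where "N e = nat \<lceil>e / \<epsilon>\<rceil>" for e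
  have N: "e \<le> real (N e) * \<epsilon>" for e
  proof -
    have "e / \<epsilon> \<le> real (N e)" unfolding N_def by (rule real_nat_ceiling_ge)
    then show ?thesis using \<open>\<epsilon> > 0\<close> by (simp add: field_simps)
  qed
  have N_mono: "N e \<le> N e'" if "e \<le> e'" for e e'
    unfolding N_def using that \<open>\<epsilon> > 0\<close> by (intro nat_mono ceiling_mono divide_right_mono) auto
  have pow: "real n * \<epsilon> \<le> e" if "pcoeff (z ^ n) e \<noteq> 0" for n e
    using that
  proof (induction n arbitrary: e)
    case 0
    then show ?case by (simp add: pcoeff_one split: if_splits)
  next
    case (Suc n)
    then have "pcoeff (z * z ^ n) e \<noteq> 0" by simp
    then obtain a b where "pcoeff z a \<noteq> 0" "pcoeff (z ^ n) b \<noteq> 0" "a + b = e"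
      by (rule pcoeff_mult_nonzero)
    then show ?case using z[of a] Suc.IH[of b] by (simp add: algebra_simps)
  qed
  have pow0: "pcoeff (z ^ n) e = 0" if "N e < n" for n e
  proof (rule ccontr)
    assume "pcoeff (z ^ n) e \<noteq> 0"
    then have "real n * \<epsilon> \<le> real (N e) * \<epsilon>" using pow N order_trans by blast
    then show False using that \<open>\<epsilon> > 0\<close> by simp
  qed
  define S where "S K = (\<Sum>n\<le>K. z ^ n)" for K :: nat
  have pcoeff_S: "pcoeff (S K) e = (\<Sum>n\<le>K. pcoeff (z ^ n) e)" for K e
    unfolding S_def by (induction K) auto
  have S_eq: "pcoeff (S K) e = pcoeff (S (N e)) e" if "N e \<le> K" for K e
    unfolding pcoeff_S using that pow0 by (intro sum.mono_neutral_right) auto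
  define y where "y = Abs_puiseux (\<lambda>e. pcoeff (S (N e)) e)"
  have "finite ({e. pcoeff (S (N e)) e \<noteq> 0} \<inter> {..a})" for a
  proof (rule finite_subset[OF _ finite_supp[of "S (N a)" a]], rule subsetI)
    fix e assume e: "e \<in> {e. pcoeff (S (N e)) e \<noteq> 0} \<inter> {..a}"
    then have "pcoeff (S (N a)) e = pcoeff (S (N e)) e" using S_eq[OF N_mono, of e a] by simp
    then show "e \<in> supp (S (N a)) \<inter> {..a}" using e by simp
  qed
  then have y: "pcoeff y e = pcoeff (S (N e)) e" for e
    unfolding y_def by (subst pcoeff_Abs_puiseux) auto
  have "(1 - z) * y = 1"
  proof (rule puiseux_eqI)
    fix e
    let ?K = "N e"
    have r: "e < b" if "pcoeff (y - S ?K) b \<noteq> 0" for b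
    proof (rule ccontr)
      assume "\<not> e < b"
      then have "N b \<le> ?K" using N_mono by simp
      then have "pcoeff (S ?K) b = pcoeff y b" unfolding y by (rule S_eq)
      then show False using that by simp
    qed
    have "pcoeff ((1 - z) * (y - S ?K)) e = 0"
    proof (rule ccontr)
      assume "pcoeff ((1 - z) * (y - S ?K)) e \<noteq> 0"
      then obtain a b where ab: "pcoeff (1 - z) a \<noteq> 0" "pcoeff (y - S ?K) b \<noteq> 0" "a + b = e"
        by (rule pcoeff_mult_nonzero)
      have "0 \<le> a" using ab(1) z[of a] \<open>\<epsilon> > 0\<close> by (auto simp: pcoeff_one split: if_splits)
      then show False using r[OF ab(2)] ab(3) by simp
    qed
    moreover have "(1 - z) * y = (1 - z) * S ?K + (1 - z) * (y - S ?K)"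
      by (simp add: algebra_simps)
    moreover have "(1 - z) * S ?K = 1 - z ^ Suc ?K"
      unfolding S_def by (rule sum_gp_basic)
    moreover have "pcoeff (z ^ Suc ?K) e = 0" by (rule pow0) simp
    ultimately show "pcoeff ((1 - z) * y) e = pcoeff 1 e" by (simp only: pcoeff_add pcoeff_diff) simp
  qed
  then show ?thesis by blast
qed

lemma puiseux_invertible:
  assumes "x \<noteq> 0"
  shows "\<exists>y. x * y = (1 :: puiseux)"
proof -
  define m where "m = leading_exponent x"
  define c where "c = pcoeff x m"
  have "c \<noteq> 0" using leading_exponent(1)[OF assms] by (simp add: c_def m_def)
  define z where "z = 1 - monomial (1 / c) (- m) * x"
  have cz: "pcoeff z e = (if e = 0 then 1 else 0) - pcoeff x (e + m) / c" for e
    by (simp add: z_def pcoeff_monomial_mult pcoeff_one)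
  have pos: "e > 0" if "pcoeff z e \<noteq> 0" for e
  proof -
    have "e \<noteq> 0" using that \<open>c \<noteq> 0\<close> by (auto simp: cz c_def)
    then have "pcoeff x (e + m) \<noteq> 0" using that by (simp add: cz)
    then have "m \<le> e + m" unfolding m_def by (rule leading_exponent(2)[OF assms])
    then show ?thesis using \<open>e \<noteq> 0\<close> by simp
  qed
  have "\<exists>\<epsilon>>0. \<forall>e. pcoeff z e \<noteq> 0 \<longrightarrow> \<epsilon> \<le> e"
  proof (cases "z = 0")
    case True
    then show ?thesis by (intro exI[of _ 1]) simp
  next
    case False
    then show ?thesis
      using leading_exponent[OF False] pos by (intro exI[of _ "leading_exponent z"]) auto
  qed
  then obtain y where "(1 - z) * y = 1" using one_minus_invertible by blast
  then have "x * (monomial (1 / c) (- m) * y) = 1" by (simp add: z_def mult_ac)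
  then show ?thesis by blast
qed

instantiation puiseux :: field
begin

definition "inverse x = (if x = 0 then 0 else SOME y. x * y = (1 :: puiseux))"
definition "x div y = x * inverse (y :: puiseux)"

instance
proof
  fix x y :: puiseux
  show "inverse x * x = 1" if "x \<noteq> 0"
    using someI_ex[OF puiseux_invertible[OF that]] that
    by (simp add: inverse_puiseux_def mult.commute)
qed (simp_all add: inverse_puiseux_def divide_puiseux_def)

end

definition K_pos :: "puiseux set" where
  "K_pos = {x. x \<noteq> 0 \<and> pcoeff x (leading_exponent x) \<in> complex_of_real ` {0<..}}"


section \<open>Laurent polynomials on a split torus\<close>

text \<open>
  Choosing bases, both the character lattice \<open>M\<close> and the cocharacter lattice \<open>N\<close> of the torus of
  dimension \<open>r = CARD('r)\<close> are \<^typ>\<open>int ^ 'r\<close>. A Laurent polynomial is an element of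
  the group algebra of \<open>M\<close> over the field of generalised Puiseux series, with \<open>c * x^v\<close> being
  \<open>Poly_Mapping.single v c\<close>.
\<close>

type_synonym 'r laurent = "(int ^ 'r) \<Rightarrow>\<^sub>0 puiseux"

definition pairing :: "int ^ 'r \<Rightarrow> int ^ 'r \<Rightarrow> int" where
  "pairing v u = (\<Sum>j\<in>UNIV. v $ j * u $ j)"

text \<open>
  A point of the torus is a group homomorphism from \<open>M\<close> to the units of the field, so that \<open>p v\<close>
  is what is usually written \<open>p^v\<close>. Preservation of \<open>0\<close> and of negation is automatic.
\<close>

definition torus_pos :: "(int ^ 'r \<Rightarrow> puiseux) set" where
  "torus_pos = {p. (\<forall>v. p v \<in> K_pos) \<and> (\<forall>v w. p (v + w) = p v * p w)}"

definition critical_point :: "'r laurent \<Rightarrow> (int ^ 'r \<Rightarrow> puiseux) \<Rightarrow> bool" where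
  "critical_point W p \<longleftrightarrow>
     (\<forall>u. (\<Sum>v\<in>Poly_Mapping.keys W. Poly_Mapping.lookup W v * of_int (pairing v u) * p v) = 0)"

definition newton_polytope :: "'r laurent \<Rightarrow> (real ^ 'r) set" where
  "newton_polytope W = convex hull ((\<lambda>v. \<chi> j. real_of_int (v $ j)) ` Poly_Mapping.keys W)"

end

theory Submission
  imports Defs
begin

text \<open>
  If \<open>0\<close> is not interior, some real \<open>u \<noteq> 0\<close> satisfies \<open>\<langle>v, u\<rangle> \<ge> 0\<close> for all exponents \<open>v\<close> of \<open>W\<close>. The
  critical equation in direction \<open>u\<close> is a vanishing sum of elements of \<open>K_pos \<union> {0}\<close>, so \<open>\<langle>v, u\<rangle> = 0\<close>
  throughout and \<open>p\<^sup>v\<close> may be multiplied by \<open>t\<close> to the power \<open>\<langle>v, u\<rangle>\<close>: critical points are not unique.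

  Let \<open>0\<close> be interior. If \<open>p\<close> and \<open>p q\<close> are positive critical points and \<open>q \<noteq> 1\<close>, there is a complex
  \<open>b \<noteq> 0\<close> such that \<open>(q\<^sup>v - 1)\<close> times the conjugate of \<open>\<langle>v, b\<rangle>\<close> is in \<open>K_pos\<close> whenever \<open>\<langle>v, b\<rangle> \<noteq> 0\<close>.
  The difference of the two critical equations, paired with the conjugate of \<open>b\<close>, is again a vanishing
  sum of positive elements, so all \<open>\<langle>v, b\<rangle>\<close> vanish, which is impossible.

  For existence, the leading terms of a critical point come from the asymptotics as \<open>t\<close> tends to \<open>0\<close>
  of the minimisers of the real function obtained by replacing the coefficients by their leading
  terms. Newton's method then converges \<open>t\<close>-adically: in a linear system with the Hessian, pairing
  with the conjugate of the lowest-order part of the solution gives a positive leading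
  coefficient, which bounds the order of the solution in terms of that of the right-hand side.
\<close>

section \<open>Asymptotics of real minimisers\<close>

text \<open>The positive parts of the \<open>V i \<bullet> u\<close> add up to a continuous function
  of \<open>u\<close>. A zero of it in the span is orthogonal to all \<open>V i\<close> by
  \<open>lineal\<close>, hence to itself. So it has a positive minimum on the unit sphere of the
  span, and homogeneity does the rest.\<close>

lemma coercive_on_span:
  fixes V :: "'i \<Rightarrow> 'a::euclidean_space"
  assumes "finite J"
    and lineal: "\<And>u. \<forall>i\<in>J. V i \<bullet> u \<le> 0 \<Longrightarrow> \<forall>i\<in>J. V i \<bullet> u = 0"
  shows "\<exists>\<delta>>0. \<forall>u\<in>span (V ` J). \<forall>B\<ge>0. (\<forall>i\<in>J. V i \<bullet> u \<le> B) \<longrightarrow> \<delta> * norm u \<le> B"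
proof -
  define h where "h u = (\<Sum>i\<in>J. max 0 (V i \<bullet> u))" for u
  let ?S = "sphere 0 1 \<inter> span (V ` J)"
  have h_pos: "h u > 0" if "u \<in> span (V ` J)" "u \<noteq> 0" for u
  proof (rule ccontr)
    assume "\<not> h u > 0"
    moreover have "h u \<ge> 0" unfolding h_def by (intro sum_nonneg) auto
    ultimately have "h u = 0" by simp
    then have "\<And>i. i \<in> J \<Longrightarrow> max 0 (V i \<bullet> u) = 0"
      unfolding h_def using assms(1) by (subst (asm) sum_nonneg_eq_0_iff) auto
    then have "\<forall>i\<in>J. V i \<bullet> u \<le> 0" by (metis max.cobounded2)
    then have "\<forall>i\<in>J. V i \<bullet> u = 0" by (rule lineal)
    then have "orthogonal u x" if "x \<in> V ` J" for x
      using that by (auto simp: orthogonal_def inner_commute)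
    then have "orthogonal u u" using orthogonal_to_span that(1) by blast
    then show False using that(2) by (simp add: orthogonal_def)
  qed
  have "compact ?S" by (intro compact_Int_closed closed_span) auto
  have cont: "continuous_on ?S h" unfolding h_def by (intro continuous_intros)
  obtain m where m: "m > 0" "\<And>u. u \<in> ?S \<Longrightarrow> m \<le> h u"
  proof (cases "?S = {}")
    case True
    then show ?thesis using that[of 1] by auto
  next
    case False
    obtain x where "x \<in> ?S" "\<And>y. y \<in> ?S \<Longrightarrow> h x \<le> h y"
      using continuous_attains_inf[OF \<open>compact ?S\<close> False cont] by blast
    then show ?thesis using that[of "h x"] h_pos[of x] by fastforce
  qed
  define N where "N = real (card J) + 1"
  have "N > 0" by (simp add: N_def)
  show ?thesis
  proof (intro exI[of _ "m / N"] conjI ballI allI impI)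
    show "m / N > 0" using m \<open>N > 0\<close> by simp
    fix u B assume u: "u \<in> span (V ` J)" "0 \<le> B" "\<forall>i\<in>J. V i \<bullet> u \<le> B"
    have "m * norm u \<le> h u"
    proof (cases "u = 0")
      case False
      have "m \<le> h ((1 / norm u) *\<^sub>R u)"
        by (rule m(2)) (use u False in \<open>auto intro: span_mul\<close>)
      also have "h ((1 / norm u) *\<^sub>R u) = (1 / norm u) * h u"
        unfolding h_def sum_distrib_left by (intro sum.cong refl) (simp add: max_mult_distrib_left)
      finally show ?thesis using False by (simp add: field_simps)
    qed (simp add: h_def)
    also have "h u \<le> real (card J) * B"
      unfolding h_def using u by (intro sum_bounded_above) auto
    also have "\<dots> \<le> N * B" using u by (simp add: N_def algebra_simps)
    finally show "m / N * norm u \<le> B" using \<open>N > 0\<close> by (simp add: field_simps)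
  qed
qed

lemma span_image_eq_UNIV:
  fixes V :: "'i \<Rightarrow> 'a::euclidean_space"
  assumes "\<And>u. (\<And>i. i \<in> I \<Longrightarrow> V i \<bullet> u = 0) \<Longrightarrow> u = 0"
  shows "span (V ` I) = UNIV"
proof -
  have "u \<in> span (V ` I)" for u
  proof -
    obtain x z where xz: "x \<in> span (V ` I)" "\<And>w. w \<in> span (V ` I) \<Longrightarrow> orthogonal z w" "u = x + z"
      using orthogonal_subspace_decomp_exists[of "V ` I" u] by blast
    have "V i \<bullet> z = 0" if "i \<in> I" for i
      using xz(2)[of "V i"] that by (simp add: span_base orthogonal_def inner_commute)
    then have "z = 0" by (rule assms)
    then show ?thesis using xz by simp
  qed
  then show ?thesis by blast
qed

text \<open>On the sublevel set of the value at \<open>0\<close> every term is bounded, so every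
  \<open>V i \<bullet> P\<close> is bounded above, and by coercivity the set is compact. The second
  conclusion is the vanishing of the directional derivatives at the minimum.\<close>

lemma exp_sum_minimizer:
  fixes V :: "'i \<Rightarrow> 'a::euclidean_space" and g :: "'i \<Rightarrow> real"
  assumes "finite I" and "\<And>i. i \<in> I \<Longrightarrow> g i > 0"
    and ndeg: "\<And>u. (\<And>i. i \<in> I \<Longrightarrow> V i \<bullet> u \<le> 0) \<Longrightarrow> u = 0"
  obtains P where "\<And>Q. (\<Sum>i\<in>I. g i * exp (V i \<bullet> P)) \<le> (\<Sum>i\<in>I. g i * exp (V i \<bullet> Q))"
    "\<And>u. (\<Sum>i\<in>I. g i * exp (V i \<bullet> P) * (V i \<bullet> u)) = 0"
proof -
  define f where "f P = (\<Sum>i\<in>I. g i * exp (V i \<bullet> P))" for P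
  have span: "span (V ` I) = UNIV"
    by (rule span_image_eq_UNIV) (use ndeg in auto)
  have lineal: "\<forall>i\<in>I. V i \<bullet> u = 0" if "\<forall>i\<in>I. V i \<bullet> u \<le> 0" for u
    using ndeg[of u] that by simp
  obtain \<delta> where \<delta>: "\<delta> > 0" "\<And>u B. 0 \<le> B \<Longrightarrow> \<forall>i\<in>I. V i \<bullet> u \<le> B \<Longrightarrow> \<delta> * norm u \<le> B"
    using coercive_on_span[OF assms(1) lineal] unfolding span by auto
  define S where "S = {P. f P \<le> f 0}"
  have contf: "continuous_on UNIV f" unfolding f_def by (intro continuous_intros)
  have "closed S" unfolding S_def
    using continuous_closed_vimage closed_Collect_le contf continuous_on_const by blast
  define B where "B = (\<Sum>i\<in>I. \<bar>ln (f 0 / g i)\<bar>)"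
  have "norm P \<le> B / \<delta>" if "P \<in> S" for P
  proof -
    have "V i \<bullet> P \<le> B" if i: "i \<in> I" for i
    proof -
      have "g i * exp (V i \<bullet> P) \<le> f P"
        unfolding f_def by (rule member_le_sum) (use assms i in \<open>auto simp: less_imp_le\<close>)
      then have "exp (V i \<bullet> P) \<le> f 0 / g i"
        using \<open>P \<in> S\<close> assms(2)[OF i] by (simp add: S_def field_simps)
      then have "V i \<bullet> P \<le> ln (f 0 / g i)"
        by (metis exp_gt_zero ln_exp ln_mono order_less_le_trans)
      also have "\<dots> \<le> \<bar>ln (f 0 / g i)\<bar>" by simp
      also have "\<dots> \<le> B" unfolding B_def by (rule member_le_sum) (use assms i in auto)
      finally show ?thesis .
    qed
    then have "\<delta> * norm P \<le> B" by (intro \<delta>(2)) (auto simp: span B_def intro: sum_nonneg)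
    then show ?thesis using \<delta>(1) by (simp add: field_simps)
  qed
  then have "bounded S" by (auto simp: bounded_iff)
  then have "compact S" using \<open>closed S\<close> by (simp add: compact_eq_bounded_closed)
  moreover have "S \<noteq> {}" by (auto simp: S_def)
  ultimately obtain P where P: "P \<in> S" "\<And>Q. Q \<in> S \<Longrightarrow> f P \<le> f Q"
    using continuous_attains_inf[of S f] contf continuous_on_subset by blast
  have min: "f P \<le> f Q" for Q using P(1) P(2)[of Q] by (cases "Q \<in> S") (auto simp: S_def)
  have "(\<Sum>i\<in>I. g i * exp (V i \<bullet> P) * (V i \<bullet> u)) = 0" for u
  proof -
    have "((\<lambda>s. f (P + s *\<^sub>R u)) has_real_derivative (\<Sum>i\<in>I. g i * exp (V i \<bullet> P) * (V i \<bullet> u))) (at 0)"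
      unfolding f_def inner_add_right inner_scaleR_right
      by (auto intro!: derivative_eq_intros sum.cong)
    then show ?thesis
      by (rule DERIV_local_min[of _ _ _ 1]) (auto intro: min)
  qed
  then show ?thesis using min that unfolding f_def by blast
qed

lemma exp_lin_tendsto_zero:
  fixes r :: "nat \<Rightarrow> real"
  assumes "filterlim r at_top sequentially" "y \<longlonglongrightarrow> e" "e < 0"
  shows "(\<lambda>n. exp (r n * y n)) \<longlonglongrightarrow> 0"
proof -
  have "filterlim (\<lambda>n. y n * r n) at_bot sequentially"
    by (rule filterlim_tendsto_neg_mult_at_bot[OF assms(2,3,1)])
  then show ?thesis
    using filterlim_compose[OF exp_at_bot] by (simp add: mult.commute)
qed

text \<open>
  Finds the exponents \<open>d\<close> and the logarithms \<open>a\<close> of the leading coefficients of the critical point.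
  With \<open>exp (- n)\<close> in place of \<open>t\<close>, let \<open>P n\<close> minimise \<open>\<Sum>i\<in>I. g i * exp (V i \<bullet> P - n * c i)\<close>.
  Along a subsequence \<open>P n / n\<close> tends to \<open>- d\<close>, then \<open>P n + n *\<^sub>R d\<close> stays bounded and accumulates at \<open>a\<close>.
\<close>

lemma leading_point_exists:
  fixes V :: "'i \<Rightarrow> 'a::euclidean_space" and g c :: "'i \<Rightarrow> real"
  assumes "finite I" and gpos: "\<And>i. i \<in> I \<Longrightarrow> g i > 0"
    and pointed: "\<forall>u. (\<forall>i\<in>I. V i \<bullet> u \<le> 0) \<longrightarrow> u = 0"
  shows "\<exists>d a. \<forall>s u. (\<forall>i\<in>I. c i + V i \<bullet> d < s \<longrightarrow> V i \<bullet> u = 0) \<longrightarrow>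
       (\<Sum>i | i \<in> I \<and> c i + V i \<bullet> d = s. g i * exp (V i \<bullet> a) * (V i \<bullet> u)) = 0"
proof -
  have ndeg: "u = 0" if "\<And>i. i \<in> I \<Longrightarrow> V i \<bullet> u \<le> 0" for u
    using pointed that by blast
  have "\<exists>P. \<forall>n::nat. (\<forall>Q. (\<Sum>i\<in>I. g i * exp (- (real n * c i)) * exp (V i \<bullet> P n))
        \<le> (\<Sum>i\<in>I. g i * exp (- (real n * c i)) * exp (V i \<bullet> Q))) \<and>
      (\<forall>u. (\<Sum>i\<in>I. g i * exp (- (real n * c i)) * exp (V i \<bullet> P n) * (V i \<bullet> u)) = 0)"
  proof -
    have "\<exists>P. (\<forall>Q. (\<Sum>i\<in>I. g i * exp (- (real n * c i)) * exp (V i \<bullet> P))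
        \<le> (\<Sum>i\<in>I. g i * exp (- (real n * c i)) * exp (V i \<bullet> Q))) \<and>
      (\<forall>u. (\<Sum>i\<in>I. g i * exp (- (real n * c i)) * exp (V i \<bullet> P) * (V i \<bullet> u)) = 0)" for n :: nat
    proof -
      have pos: "g i * exp (- (real n * c i)) > 0" if "i \<in> I" for i
        using gpos[OF that] by simp
      show ?thesis
        using exp_sum_minimizer[where g = "\<lambda>i. g i * exp (- (real n * c i))" and V = V and I = I,
            OF assms(1) pos ndeg]
        by blast
    qed
    then show ?thesis by (intro choice allI)
  qed
  then obtain P where
    Pmin: "\<And>n Q. (\<Sum>i\<in>I. g i * exp (- (real n * c i)) * exp (V i \<bullet> P n))
        \<le> (\<Sum>i\<in>I. g i * exp (- (real n * c i)) * exp (V i \<bullet> Q))" and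
    Pcrit: "\<And>n u. (\<Sum>i\<in>I. g i * exp (- (real n * c i)) * exp (V i \<bullet> P n) * (V i \<bullet> u)) = 0"
    by blast
  have span: "span (V ` I) = UNIV"
    by (rule span_image_eq_UNIV) (use ndeg in auto)
  have lineal_I: "\<forall>i\<in>I. V i \<bullet> u = 0" if "\<forall>i\<in>I. V i \<bullet> u \<le> 0" for u
    using ndeg[of u] that by simp
  obtain \<delta> where "\<delta> > 0" and \<delta>: "\<And>u B. 0 \<le> B \<Longrightarrow> \<forall>i\<in>I. V i \<bullet> u \<le> B \<Longrightarrow> \<delta> * norm u \<le> B"
    using coercive_on_span[OF assms(1) lineal_I] unfolding span by auto
  \<comment> \<open>Comparison with the point \<open>0\<close> bounds each term of the minimum by
    \<open>G * exp (n * C)\<close>; after taking logarithms, \<open>V i \<bullet> P n\<close> grows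
    at most linearly in \<open>n\<close>.\<close>
  have "\<exists>B\<ge>0. \<forall>n. norm ((1 / real (Suc n)) *\<^sub>R P (Suc n)) \<le> B"
  proof -
    define G where "G = (\<Sum>j\<in>I. g j)"
    define C where "C = (\<Sum>j\<in>I. \<bar>c j\<bar>)"
    define B where "B = (\<Sum>i\<in>I. \<bar>ln (G / g i)\<bar> + C + \<bar>c i\<bar>)"
    have C: "\<bar>c i\<bar> \<le> C" if "i \<in> I" for i
      unfolding C_def by (rule member_le_sum) (use that assms in auto)
    have "C \<ge> 0" unfolding C_def by (intro sum_nonneg) auto
    then have "B \<ge> 0" unfolding B_def by (intro sum_nonneg) auto
    have up: "V i \<bullet> P n \<le> real n * B" if i: "i \<in> I" and n: "n \<ge> 1" for i n
    proof -
      have "g i * exp (- (real n * c i)) * exp (V i \<bullet> P n)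
          \<le> (\<Sum>i\<in>I. g i * exp (- (real n * c i)) * exp (V i \<bullet> P n))"
        by (rule member_le_sum) (use assms i in \<open>auto simp: less_imp_le\<close>)
      also have "\<dots> \<le> (\<Sum>i\<in>I. g i * exp (- (real n * c i)))"
        using Pmin[of n 0] by simp
      also have "\<dots> \<le> (\<Sum>i\<in>I. g i * exp (real n * C))"
      proof (rule sum_mono)
        fix j assume j: "j \<in> I"
        have "real n * - c j \<le> real n * C" using C[OF j] by (intro mult_left_mono) auto
        then show "g j * exp (- (real n * c j)) \<le> g j * exp (real n * C)"
          using gpos[OF j] by simp
      qed
      also have "\<dots> = G * exp (real n * C)" by (simp add: G_def sum_distrib_right)
      finally have le: "exp (V i \<bullet> P n) \<le> G / g i * exp (real n * C + real n * c i)"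
        using gpos[OF i] by (simp add: exp_minus exp_add field_simps)
      have "G > 0" unfolding G_def using i assms by (intro sum_pos) auto
      then have "V i \<bullet> P n \<le> ln (G / g i * exp (real n * C + real n * c i))"
        using le by (metis exp_gt_zero ln_exp ln_mono order_less_le_trans)
      also have "\<dots> = ln (G / g i) + (real n * C + real n * c i)"
        using \<open>G > 0\<close> gpos[OF i] by (subst ln_mult_pos) auto
      also have "\<dots> \<le> real n * \<bar>ln (G / g i)\<bar> + (real n * C + real n * \<bar>c i\<bar>)"
      proof -
        have "ln (G / g i) \<le> 1 * \<bar>ln (G / g i)\<bar>" by simp
        also have "\<dots> \<le> real n * \<bar>ln (G / g i)\<bar>" using n by (intro mult_right_mono) auto
        finally show ?thesis by (intro add_mono mult_left_mono) auto
      qed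
      also have "\<dots> = real n * (\<bar>ln (G / g i)\<bar> + C + \<bar>c i\<bar>)" by (simp add: algebra_simps)
      also have "\<dots> \<le> real n * B"
        unfolding B_def using i assms \<open>C \<ge> 0\<close> by (intro mult_left_mono member_le_sum) auto
      finally show ?thesis .
    qed
    have "norm ((1 / real (Suc n)) *\<^sub>R P (Suc n)) \<le> B / \<delta>" for n
    proof -
      have "\<delta> * norm ((1 / real (Suc n)) *\<^sub>R P (Suc n)) \<le> B"
      proof (rule \<delta>[OF \<open>B \<ge> 0\<close>], rule ballI)
        fix i assume "i \<in> I"
        then show "V i \<bullet> ((1 / real (Suc n)) *\<^sub>R P (Suc n)) \<le> B"
          using up[of i "Suc n"] by (simp add: field_simps del: of_nat_Suc)
      qed
      then show ?thesis using \<open>\<delta> > 0\<close> by (simp add: field_simps del: of_nat_Suc)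
    qed
    then show ?thesis using \<open>B \<ge> 0\<close> \<open>\<delta> > 0\<close> by (intro exI[of _ "B / \<delta>"]) auto
  qed
  then have "bounded (range (\<lambda>n. (1 / real (Suc n)) *\<^sub>R P (Suc n)))" by (auto simp: bounded_iff)
  then obtain l \<rho> where \<rho>: "strict_mono \<rho>"
      and lim: "((\<lambda>n. (1 / real (Suc n)) *\<^sub>R P (Suc n)) \<circ> \<rho>) \<longlonglongrightarrow> l"
    using bounded_imp_convergent_subsequence by blast
  \<comment> \<open>With this \<open>d\<close> the shifted minimisers \<open>A n\<close> are of
    smaller order than \<open>r n\<close>; \<open>D i\<close> is the exponent of the term
    \<open>i\<close> at a point of valuation \<open>d\<close>.\<close>
  define d where "d = - l"
  define r where "r n = real (Suc (\<rho> n))" for n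
  define A where "A n = P (Suc (\<rho> n)) + r n *\<^sub>R d" for n
  define D where "D i = c i + V i \<bullet> d" for i
  have rpos: "r n > 0" for n by (simp add: r_def)
  have rlim: "filterlim r at_top sequentially"
    unfolding r_def using filterlim_subseq[OF \<rho>] filterlim_real_sequentially filterlim_Suc filterlim_compose by blast
  have Alim: "(\<lambda>n. (1 / r n) *\<^sub>R A n) \<longlonglongrightarrow> 0"
  proof -
    have "(\<lambda>n. (1 / r n) *\<^sub>R P (Suc (\<rho> n)) + d) \<longlonglongrightarrow> l + d"
      using lim by (intro tendsto_add tendsto_const) (simp add: r_def o_def)
    moreover have "(1 / r n) *\<^sub>R A n = (1 / r n) *\<^sub>R P (Suc (\<rho> n)) + d" for n
      using rpos[of n] by (simp add: A_def scaleR_add_right)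
    ultimately show ?thesis by (simp add: d_def)
  qed
  have expo: "g i * exp (- (r n * c i)) * exp (V i \<bullet> (Q - r n *\<^sub>R d)) = g i * exp (V i \<bullet> Q - r n * D i)" for i n Q
    by (simp add: D_def inner_diff_right algebra_simps flip: exp_add)
  have PA: "P (Suc (\<rho> n)) = A n - r n *\<^sub>R d" for n by (simp add: A_def)
  have Amin: "(\<Sum>i\<in>I. g i * exp (V i \<bullet> A n - r n * D i)) \<le> (\<Sum>i\<in>I. g i * exp (V i \<bullet> Q - r n * D i))" for n Q
    using Pmin[of "Suc (\<rho> n)" "Q - r n *\<^sub>R d"] unfolding r_def[symmetric] PA expo .
  have Acrit: "(\<Sum>i\<in>I. g i * exp (V i \<bullet> A n - r n * D i) * (V i \<bullet> u)) = 0" for n u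
    using Pcrit[of "Suc (\<rho> n)" u] unfolding r_def[symmetric] PA expo .
  \<comment> \<open>Since \<open>A n\<close> is of smaller order than \<open>r n\<close>, terms of
    level above \<open>s\<close> are exponentially smaller than the term \<open>i\<close>. In the
    critical equation along \<open>u\<close> they cannot balance a negative contribution of
    \<open>i\<close> when no term of level at most \<open>s\<close> contributes positively.\<close>
  have lineal: "V i \<bullet> u = 0"
    if u: "\<And>i. i \<in> I \<Longrightarrow> D i \<le> s \<Longrightarrow> V i \<bullet> u \<le> 0" and i: "i \<in> I" "D i \<le> s" for s u i
  proof (rule ccontr)
    assume "V i \<bullet> u \<noteq> 0"
    then have neg: "V i \<bullet> u < 0" using u[OF i] by simp
    let ?J = "{j \<in> I. D j > s}"
    \<comment> \<open>The total size of the terms above level \<open>s\<close>, relative to the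
      exponential in the term \<open>i\<close>.\<close>
    define R where "R n = (\<Sum>j\<in>?J. g j * exp (r n * (((V j - V i) \<bullet> ((1 / r n) *\<^sub>R A n)) - (D j - D i))) * \<bar>V j \<bullet> u\<bar>)" for n
    have "R \<longlonglongrightarrow> (\<Sum>j\<in>?J. g j * 0 * \<bar>V j \<bullet> u\<bar>)"
      unfolding R_def
    proof (intro tendsto_sum tendsto_mult tendsto_const exp_lin_tendsto_zero[OF rlim])
      fix j assume "j \<in> ?J"
      show "(\<lambda>n. (V j - V i) \<bullet> ((1 / r n) *\<^sub>R A n) - (D j - D i)) \<longlonglongrightarrow> (V j - V i) \<bullet> 0 - (D j - D i)"
        by (intro tendsto_diff tendsto_inner tendsto_const Alim)
      show "(V j - V i) \<bullet> 0 - (D j - D i) < 0" using \<open>j \<in> ?J\<close> i by simp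
    qed
    then have "R \<longlonglongrightarrow> 0" by simp
    moreover have "g i * \<bar>V i \<bullet> u\<bar> \<le> R n" for n
    proof -
      define E where "E = exp (V i \<bullet> A n - r n * D i)"
      have "E > 0" by (simp add: E_def)
      have e: "exp (r n * (((V j - V i) \<bullet> ((1 / r n) *\<^sub>R A n)) - (D j - D i))) * E = exp (V j \<bullet> A n - r n * D j)" for j
        unfolding E_def using rpos[of n]
        by (simp add: inner_diff_left algebra_simps flip: exp_add)
      have "0 = (\<Sum>j\<in>I. g j * exp (V j \<bullet> A n - r n * D j) * (V j \<bullet> u))" using Acrit by simp
      also have "\<dots> \<le> (\<Sum>j\<in>I. (if j = i then g i * E * (V i \<bullet> u) else 0) +
          (if D j > s then g j * exp (V j \<bullet> A n - r n * D j) * \<bar>V j \<bullet> u\<bar> else 0))"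
      proof (rule sum_mono)
        fix j assume j: "j \<in> I"
        have "g j * exp (V j \<bullet> A n - r n * D j) > 0" using gpos[OF j] by simp
        then show "g j * exp (V j \<bullet> A n - r n * D j) * (V j \<bullet> u) \<le> (if j = i then g i * E * (V i \<bullet> u) else 0) +
          (if D j > s then g j * exp (V j \<bullet> A n - r n * D j) * \<bar>V j \<bullet> u\<bar> else 0)"
          using i u[OF j] by (auto simp: E_def mult_le_0_iff intro!: mult_left_mono)
      qed
      also have "\<dots> = g i * E * (V i \<bullet> u) + (\<Sum>j\<in>?J. g j * exp (V j \<bullet> A n - r n * D j) * \<bar>V j \<bullet> u\<bar>)"
        using i assms(1) by (simp add: sum.distrib sum.inter_filter)
      also have "(\<Sum>j\<in>?J. g j * exp (V j \<bullet> A n - r n * D j) * \<bar>V j \<bullet> u\<bar>) = E * R n"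
        unfolding R_def sum_distrib_left e[symmetric] by (intro sum.cong refl) (simp only: mult_ac)
      finally have "E * (g i * \<bar>V i \<bullet> u\<bar>) \<le> E * R n" using neg by (simp add: algebra_simps)
      then show ?thesis using \<open>E > 0\<close> by simp
    qed
    ultimately have "g i * \<bar>V i \<bullet> u\<bar> \<le> 0" by (metis LIMSEQ_le_const)
    then show False using gpos[OF i(1)] neg mult_pos_neg[of "g i" "V i \<bullet> u"] by simp
  qed
  \<comment> \<open>Coercivity controls the projection \<open>x\<close> of \<open>A n\<close> to the
    span of the \<open>V i\<close> with \<open>i\<close> in \<open>J\<close>; the orthogonal part
    \<open>z\<close> does not affect these \<open>V i \<bullet> A n\<close>.\<close>
  have split: "\<exists>\<beta>. \<forall>n. \<exists>x z. A n = x + z \<and> norm x \<le> \<beta> \<and> (\<forall>i\<in>J. V i \<bullet> z = 0)"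
    if J: "J \<subseteq> I" "\<And>u. \<forall>i\<in>J. V i \<bullet> u \<le> 0 \<Longrightarrow> \<forall>i\<in>J. V i \<bullet> u = 0"
      and bd: "\<And>i. i \<in> J \<Longrightarrow> \<exists>B. \<forall>n. V i \<bullet> A n \<le> B" for J
  proof -
    have finJ: "finite J" using J(1) assms(1) finite_subset by blast
    obtain \<epsilon> where \<epsilon>: "\<epsilon> > 0"
        "\<And>u B. u \<in> span (V ` J) \<Longrightarrow> 0 \<le> B \<Longrightarrow> \<forall>i\<in>J. V i \<bullet> u \<le> B \<Longrightarrow> \<epsilon> * norm u \<le> B"
      using coercive_on_span[OF finJ J(2)] by auto
    obtain B where B: "\<And>i n. i \<in> J \<Longrightarrow> V i \<bullet> A n \<le> B i" using bd by metis
    define \<beta> where "\<beta> = (\<Sum>i\<in>J. \<bar>B i\<bar>)"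
    have "\<exists>x z. A n = x + z \<and> norm x \<le> \<beta> / \<epsilon> \<and> (\<forall>i\<in>J. V i \<bullet> z = 0)" for n
    proof -
      obtain x z where xz: "x \<in> span (V ` J)" "\<And>w. w \<in> span (V ` J) \<Longrightarrow> orthogonal z w" "A n = x + z"
        using orthogonal_subspace_decomp_exists[of "V ` J" "A n"] by blast
      have z: "V i \<bullet> z = 0" if "i \<in> J" for i
        using xz(2)[of "V i"] that by (simp add: span_base orthogonal_def inner_commute)
      have "\<epsilon> * norm x \<le> \<beta>"
      proof (rule \<epsilon>(2)[OF xz(1)])
        show "0 \<le> \<beta>" unfolding \<beta>_def by (intro sum_nonneg) auto
        show "\<forall>i\<in>J. V i \<bullet> x \<le> \<beta>"
        proof
          fix i assume i: "i \<in> J"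
          have "V i \<bullet> x = V i \<bullet> A n" using z[OF i] xz(3) by (simp add: inner_add_right)
          also have "\<dots> \<le> \<bar>B i\<bar>" using B[OF i, of n] by simp
          also have "\<dots> \<le> \<beta>" unfolding \<beta>_def by (rule member_le_sum) (use finJ i in auto)
          finally show "V i \<bullet> x \<le> \<beta>" .
        qed
      qed
      then show ?thesis using xz(3) z \<epsilon>(1) by (intro exI[of _ x] exI[of _ z]) (auto simp: field_simps)
    qed
    then show ?thesis by blast
  qed
  \<comment> \<open>Induction on the level \<open>D i\<close>: dropping from \<open>A n\<close> the part orthogonal to the lower levels does not
    change the lower terms of the minimised sum, so minimality bounds the terms of level \<open>D i\<close>.\<close>
  have bound: "\<exists>B. \<forall>n. V i \<bullet> A n \<le> B" if "i \<in> I" for i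
    using that
  proof (induction "card {j \<in> I. D j < D i}" arbitrary: i rule: less_induct)
    case less
    let ?J = "{j \<in> I. D j < D i}" and ?K = "{j \<in> I. D j \<ge> D i}"
    have IH: "\<exists>B. \<forall>n. V j \<bullet> A n \<le> B" if "j \<in> ?J" for j
    proof (rule less.hyps)
      show "card {j' \<in> I. D j' < D j} < card ?J"
        using that assms(1) by (intro psubset_card_mono) auto
    qed (use that in auto)
    have lin: "\<forall>j\<in>?J. V j \<bullet> u = 0" if u: "\<forall>j\<in>?J. V j \<bullet> u \<le> 0" for u
    proof
      fix j assume j: "j \<in> ?J"
      \<comment> \<open>The highest level below \<open>D i\<close>: the indices of level at most
        \<open>s\<close> are exactly those in \<open>?J\<close>.\<close>
      define s where "s = Max (D ` ?J)"
      have "D k \<le> s" if "k \<in> ?J" for k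
        unfolding s_def using assms(1) that by (intro Max_ge) auto
      moreover have "s < D i"
        unfolding s_def using assms(1) j by (subst Max_less_iff) auto
      ultimately show "V j \<bullet> u = 0" using lineal[of s u j] u j by fastforce
    qed
    obtain \<beta> where \<beta>: "\<And>n. \<exists>x z. A n = x + z \<and> norm x \<le> \<beta> \<and> (\<forall>i\<in>?J. V i \<bullet> z = 0)"
      using split[OF _ lin IH] by blast
    define C where "C = (\<Sum>j\<in>?K. g j * exp (norm (V j) * \<beta>))"
    have "V i \<bullet> A n \<le> ln (C / g i)" for n
    proof -
      obtain x z where xz: "A n = x + z" "norm x \<le> \<beta>" "\<And>j. j \<in> ?J \<Longrightarrow> V j \<bullet> z = 0" using \<beta>[of n] by blast
      have IJ: "I = ?J \<union> ?K" by auto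
      have sp: "sum F I = sum F ?J + sum F ?K" for F :: "'i \<Rightarrow> real"
        by (subst IJ, rule sum.union_disjoint) (use assms(1) in auto)
      have "(\<Sum>j\<in>?J. g j * exp (V j \<bullet> A n - r n * D j)) = (\<Sum>j\<in>?J. g j * exp (V j \<bullet> x - r n * D j))"
        by (intro sum.cong refl) (simp add: xz inner_add_right)
      then have 1: "(\<Sum>j\<in>?K. g j * exp (V j \<bullet> A n - r n * D j)) \<le> (\<Sum>j\<in>?K. g j * exp (V j \<bullet> x - r n * D j))"
        using Amin[of n x] by (simp add: sp)
      have "g i * exp (V i \<bullet> A n - r n * D i) \<le> (\<Sum>j\<in>?K. g j * exp (V j \<bullet> A n - r n * D j))"
        by (rule member_le_sum) (use assms less.prems in \<open>auto simp: less_imp_le\<close>)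
      also note 1
      also have "(\<Sum>j\<in>?K. g j * exp (V j \<bullet> x - r n * D j)) \<le> (\<Sum>j\<in>?K. g j * exp (norm (V j) * \<beta>) * exp (- (r n * D i)))"
      proof (rule sum_mono)
        fix j assume j: "j \<in> ?K"
        have "V j \<bullet> x \<le> norm (V j) * \<beta>"
          using norm_cauchy_schwarz[of "V j" x] xz(2) by (meson mult_left_mono norm_ge_zero order_trans)
        moreover have "r n * D i \<le> r n * D j" using rpos[of n] j by simp
        ultimately have "V j \<bullet> x - r n * D j \<le> norm (V j) * \<beta> + - (r n * D i)" by simp
        then show "g j * exp (V j \<bullet> x - r n * D j) \<le> g j * exp (norm (V j) * \<beta>) * exp (- (r n * D i))"
          using gpos j by (simp flip: exp_add)
      qed
      also have "\<dots> = C * exp (- (r n * D i))" by (simp add: C_def sum_distrib_right)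
      finally have "exp (V i \<bullet> A n) \<le> C / g i"
        using gpos[OF less.prems] by (simp add: exp_diff exp_minus field_simps)
      then show ?thesis by (metis exp_gt_zero ln_exp ln_mono order_less_le_trans)
    qed
    then show ?case by blast
  qed
  have "\<exists>\<beta>. \<forall>n. norm (A n) \<le> \<beta>"
  proof -
    obtain \<beta> where \<beta>: "\<And>n. \<exists>x z. A n = x + z \<and> norm x \<le> \<beta> \<and> (\<forall>i\<in>I. V i \<bullet> z = 0)"
      using split[OF order_refl lineal_I bound] by blast
    have "norm (A n) \<le> \<beta>" for n
    proof -
      obtain x z where xz: "A n = x + z" "norm x \<le> \<beta>" "\<forall>i\<in>I. V i \<bullet> z = 0" using \<beta>[of n] by blast
      then have "z = 0" using ndeg[of z] by simp
      then show ?thesis using xz by simp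
    qed
    then show ?thesis by blast
  qed
  then have "bounded (range A)" by (auto simp: bounded_iff)
  then obtain a \<sigma> where \<sigma>: "strict_mono \<sigma>" and alim: "(A \<circ> \<sigma>) \<longlonglongrightarrow> a"
    using bounded_imp_convergent_subsequence by blast
  have rlim': "filterlim (\<lambda>n. r (\<sigma> n)) at_top sequentially"
    using filterlim_subseq[OF \<sigma>] rlim filterlim_compose by blast
  have alim': "(\<lambda>n. V i \<bullet> A (\<sigma> n)) \<longlonglongrightarrow> V i \<bullet> a" for i
    using alim by (intro tendsto_inner tendsto_const) (simp add: o_def)
  show ?thesis
  proof (intro exI allI impI)
    fix s u assume u: "\<forall>i\<in>I. c i + V i \<bullet> d < s \<longrightarrow> V i \<bullet> u = 0"
    \<comment> \<open>The critical equation rescaled by \<open>exp (r * s)\<close>: terms below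
      level \<open>s\<close> vanish by the assumption on \<open>u\<close>, those at level
      \<open>s\<close> converge, those above tend to \<open>0\<close>.\<close>
    have "(\<lambda>n. \<Sum>i\<in>I. g i * (exp (V i \<bullet> A (\<sigma> n)) * exp (r (\<sigma> n) * (s - D i))) * (V i \<bullet> u)) \<longlonglongrightarrow>
       (\<Sum>i\<in>I. if D i = s then g i * exp (V i \<bullet> a) * (V i \<bullet> u) else 0)"
    proof (rule tendsto_sum)
      fix i assume i: "i \<in> I"
      consider "D i < s" | "D i = s" | "D i > s" by linarith
      then show "(\<lambda>n. g i * (exp (V i \<bullet> A (\<sigma> n)) * exp (r (\<sigma> n) * (s - D i))) * (V i \<bullet> u)) \<longlonglongrightarrow>
         (if D i = s then g i * exp (V i \<bullet> a) * (V i \<bullet> u) else 0)"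
      proof cases
        case 1
        then show ?thesis using u i by (simp add: D_def)
      next
        case 2
        then show ?thesis using alim'[of i] by (auto intro!: tendsto_intros)
      next
        case 3
        have "(\<lambda>n. exp (r (\<sigma> n) * (s - D i))) \<longlonglongrightarrow> 0"
          by (rule exp_lin_tendsto_zero[OF rlim' tendsto_const]) (use 3 in simp)
        then have "(\<lambda>n. g i * (exp (V i \<bullet> A (\<sigma> n)) * exp (r (\<sigma> n) * (s - D i))) * (V i \<bullet> u)) \<longlonglongrightarrow>
           g i * (exp (V i \<bullet> a) * 0) * (V i \<bullet> u)"
          using alim'[of i] by (intro tendsto_mult tendsto_exp tendsto_const)
        then show ?thesis using 3 by simp
      qed
    qed
    moreover have "(\<Sum>i\<in>I. g i * (exp (V i \<bullet> A (\<sigma> n)) * exp (r (\<sigma> n) * (s - D i))) * (V i \<bullet> u)) = 0" for n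
    proof -
      have "(\<Sum>i\<in>I. g i * (exp (V i \<bullet> A (\<sigma> n)) * exp (r (\<sigma> n) * (s - D i))) * (V i \<bullet> u)) =
         exp (r (\<sigma> n) * s) * (\<Sum>i\<in>I. g i * exp (V i \<bullet> A (\<sigma> n) - r (\<sigma> n) * D i) * (V i \<bullet> u))"
        unfolding sum_distrib_left
        by (intro sum.cong refl) (simp add: exp_diff right_diff_distrib)
      then show ?thesis using Acrit by simp
    qed
    ultimately have "(\<Sum>i\<in>I. if D i = s then g i * exp (V i \<bullet> a) * (V i \<bullet> u) else 0) = 0"
      by (simp only: LIMSEQ_const_iff)
    then show "(\<Sum>i | i \<in> I \<and> c i + V i \<bullet> d = s. g i * exp (V i \<bullet> a) * (V i \<bullet> u)) = 0"
      using assms(1) by (simp add: D_def flip: sum.inter_filter)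
  qed
qed


section \<open>Positive elements and monomials\<close>

text \<open>A lower bound for the valuation, put as a predicate: \<open>0\<close> satisfies every
  bound, so no infinite value has to be introduced.\<close>

definition vge :: "puiseux \<Rightarrow> real \<Rightarrow> bool" where
  "vge x e \<longleftrightarrow> (\<forall>\<mu>. pcoeff x \<mu> \<noteq> 0 \<longrightarrow> e \<le> \<mu>)"

lemma pcoeff_sum: "pcoeff (sum f A) e = (\<Sum>i\<in>A. pcoeff (f i) e)"
  by (induction A rule: infinite_finite_induct) auto

lemma vge_0 [simp]: "vge 0 e"
  by (simp add: vge_def)

lemma vge_1: "e \<le> 0 \<Longrightarrow> vge 1 e"
  by (simp add: vge_def pcoeff_one)

lemma vge_mono: "vge x e \<Longrightarrow> f \<le> e \<Longrightarrow> vge x f"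
  by (force simp: vge_def)

lemma vge_pcoeff_eq_0: "vge x e \<Longrightarrow> \<mu> < e \<Longrightarrow> pcoeff x \<mu> = 0"
  by (force simp: vge_def)

lemma vge_add: "vge x e \<Longrightarrow> vge y e \<Longrightarrow> vge (x + y) e"
  by (force simp: vge_def)

lemma vge_diff: "vge x e \<Longrightarrow> vge y e \<Longrightarrow> vge (x - y) e"
  by (force simp: vge_def)

lemma vge_minus: "vge x e \<Longrightarrow> vge (- x) e"
  by (simp add: vge_def)

lemma vge_sum: "(\<And>i. i \<in> A \<Longrightarrow> vge (f i) e) \<Longrightarrow> vge (sum f A) e"
  by (induction A rule: infinite_finite_induct) (auto intro: vge_add)

lemma vge_mult:
  assumes "vge x e" "vge y f"
  shows "vge (x * y) (e + f)"
  unfolding vge_def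
proof (intro allI impI)
  fix \<mu> assume "pcoeff (x * y) \<mu> \<noteq> 0"
  then obtain a b where "pcoeff x a \<noteq> 0" "pcoeff y b \<noteq> 0" "a + b = \<mu>"
    by (rule pcoeff_mult_nonzero)
  then show "e + f \<le> \<mu>" using assms unfolding vge_def by (metis add_mono)
qed

text \<open>Only the pair of lowest exponents can contribute at the sum of the two bounds.\<close>

lemma pcoeff_mult_bottom:
  assumes "vge x e" "vge y f"
  shows "pcoeff (x * y) (e + f) = pcoeff x e * pcoeff y f"
proof -
  have "pcoeff (x * y) (e + f) =
    (\<Sum>a\<in>{e}. \<Sum>b\<in>{f}. if a + b = e + f then pcoeff x a * pcoeff y b else 0)"
  proof (rule pcoeff_mult)
    fix a b assume "pcoeff x a \<noteq> 0" "pcoeff y b \<noteq> 0" "a + b = e + f"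
    then show "a \<in> {e} \<and> b \<in> {f}" using assms unfolding vge_def by force
  qed auto
  then show ?thesis by simp
qed

lemma vge_leading_exponent: "x \<noteq> 0 \<Longrightarrow> vge x (leading_exponent x)"
  by (simp add: vge_def leading_exponent(2))

lemma leading_exponent_eq:
  assumes "vge x e" "pcoeff x e \<noteq> 0"
  shows "leading_exponent x = e"
  unfolding leading_exponent_def using assms by (intro Least_equality) (auto simp: vge_def)

section \<open>Constant series\<close>

definition cst :: "complex \<Rightarrow> puiseux" where
  "cst c = monomial c 0"

lemma pcoeff_cst_mult [simp]: "pcoeff (cst c * x) e = c * pcoeff x e"
  by (simp add: cst_def pcoeff_monomial_mult)

lemma pcoeff_mult_cst [simp]: "pcoeff (x * cst c) e = pcoeff x e * c"
  by (simp add: mult.commute[of x])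

lemma pcoeff_cst: "pcoeff (cst c) e = (if e = 0 then c else 0)"
  by (simp add: cst_def pcoeff_monomial)

lemma cst_simps [simp]:
  "cst 0 = 0" "cst 1 = 1" "cst (a + b) = cst a + cst b" "cst (- a) = - cst a"
  "cst (a - b) = cst a - cst b"
  "cst (a * b) = cst a * cst b"
  by (auto intro!: puiseux_eqI simp: pcoeff_cst pcoeff_one)

lemma cst_of_nat [simp]: "cst (of_nat n) = of_nat n"
  by (induction n) auto

lemma cst_of_int [simp]: "cst (of_int n) = of_int n"
  by (cases n) (auto simp del: of_nat_Suc)

lemma cst_sum: "cst (sum f A) = (\<Sum>i\<in>A. cst (f i))"
  by (induction A rule: infinite_finite_induct) auto

lemma pcoeff_of_int_mult [simp]: "pcoeff (of_int n * x) e = of_int n * pcoeff x e"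
  using pcoeff_cst_mult[of "of_int n" x e] by (simp del: pcoeff_cst_mult)

lemma vge_of_int_mult: "vge x e \<Longrightarrow> vge (of_int n * x) e"
  by (auto simp: vge_def)

lemma monomial_mult: "monomial c m * monomial d n = monomial (c * d) (m + n)"
  by (rule puiseux_eqI) (auto simp: pcoeff_monomial_mult pcoeff_monomial)

section \<open>Leading coefficients and positivity\<close>

text \<open>The real part serves to make this real-valued; for elements of \<open>K_pos\<close> the
  leading coefficient is real already.\<close>

definition lc :: "puiseux \<Rightarrow> real" where
  "lc x = Re (pcoeff x (leading_exponent x))"

lemma K_posI:
  assumes "vge x e" "pcoeff x e = of_real r" "r > 0"
  shows "x \<in> K_pos" "leading_exponent x = e" "lc x = r"
proof -
  have nz: "pcoeff x e \<noteq> 0" using assms by simp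
  then show "leading_exponent x = e" by (rule leading_exponent_eq[OF assms(1)])
  then show "x \<in> K_pos" "lc x = r"
    using assms nz by (auto simp: K_pos_def lc_def)
qed

lemma K_posD:
  assumes "x \<in> K_pos"
  shows "x \<noteq> 0" "vge x (leading_exponent x)" "pcoeff x (leading_exponent x) = of_real (lc x)" "lc x > 0"
  using assms vge_leading_exponent[of x] by (auto simp: K_pos_def lc_def)

lemma K_pos_mult:
  assumes "x \<in> K_pos" "y \<in> K_pos"
  shows "x * y \<in> K_pos" "leading_exponent (x * y) = leading_exponent x + leading_exponent y"
    "lc (x * y) = lc x * lc y"
proof -
  note x = K_posD[OF assms(1)] and y = K_posD[OF assms(2)]
  have "vge (x * y) (leading_exponent x + leading_exponent y)"
    "pcoeff (x * y) (leading_exponent x + leading_exponent y) = of_real (lc x * lc y)"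
    "lc x * lc y > 0"
    using vge_mult[OF x(2) y(2)] pcoeff_mult_bottom[OF x(2) y(2)] x y by auto
  from K_posI[OF this] show "x * y \<in> K_pos"
    "leading_exponent (x * y) = leading_exponent x + leading_exponent y" "lc (x * y) = lc x * lc y"
    by auto
qed

lemma K_pos_monomial: "r > 0 \<Longrightarrow> monomial (of_real r) m \<in> K_pos"
  by (rule K_posI[of _ m r]) (auto simp: vge_def pcoeff_monomial)

lemma K_pos_1: "1 \<in> K_pos"
  by (rule K_posI[of _ 0 1]) (auto simp: vge_def pcoeff_one)

lemma K_pos_inverse:
  assumes "x \<in> K_pos"
  shows "inverse x \<in> K_pos" "leading_exponent (inverse x) = - leading_exponent x"
    "lc (inverse x) = inverse (lc x)"
proof -
  note x = K_posD[OF assms]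
  define y where "y = inverse x"
  have xy: "x * y = 1" using x(1) by (simp add: y_def)
  then have y0: "y \<noteq> 0" by auto
  have "pcoeff (x * y) (leading_exponent x + leading_exponent y) =
      of_real (lc x) * pcoeff y (leading_exponent y)"
    using pcoeff_mult_bottom[OF x(2) vge_leading_exponent[OF y0]] x(3) by simp
  then have e: "leading_exponent y = - leading_exponent x"
    and c: "of_real (lc x) * pcoeff y (leading_exponent y) = 1"
    using xy x(4) leading_exponent(1)[OF y0] by (auto simp: pcoeff_one split: if_splits)
  have "pcoeff y (- leading_exponent x) = of_real (inverse (lc x))"
    using c x(4) by (simp add: e field_simps)
  moreover have "vge y (- leading_exponent x)" using vge_leading_exponent[OF y0] e by simp
  moreover have "inverse (lc x) > 0" using x(4) by simp
  ultimately show "inverse x \<in> K_pos" "leading_exponent (inverse x) = - leading_exponent x"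
    "lc (inverse x) = inverse (lc x)"
    unfolding y_def using K_posI by blast+
qed

text \<open>The term of lowest exponent survives: when the leading exponents agree, two positive
  coefficients cannot cancel.\<close>

lemma K_pos_add:
  assumes "x \<in> K_pos" "y \<in> K_pos"
  shows "x + y \<in> K_pos"
proof -
  have *: "x + y \<in> K_pos" if x: "x \<in> K_pos" and y: "y \<in> K_pos"
    and le: "leading_exponent x \<le> leading_exponent y" for x y
  proof (rule K_posI)
    let ?e = "leading_exponent x"
    note x = K_posD[OF x] and y = K_posD[OF y]
    show "vge (x + y) ?e" using x(2) vge_mono[OF y(2) le] by (rule vge_add)
    show "pcoeff (x + y) ?e = of_real (lc x + (if leading_exponent y = ?e then lc y else 0))"
      using x(3) y(3) vge_pcoeff_eq_0[OF y(2), of ?e] le by auto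
    show "lc x + (if leading_exponent y = ?e then lc y else 0) > 0" using x(4) y(4) by auto
  qed
  show ?thesis using *[of x y] *[of y x] assms add.commute[of x y] by (metis linear)
qed

text \<open>Positivity excludes cancellation, as \<open>K_pos\<close> is closed under addition and
  does not contain \<open>0\<close>. Both uniqueness and its failure rest on this.\<close>

lemma K_pos_sum_eq_0:
  assumes "finite A" "\<And>i. i \<in> A \<Longrightarrow> f i = 0 \<or> f i \<in> K_pos" "sum f A = 0"
  shows "\<forall>i\<in>A. f i = 0"
proof -
  have "(sum f A = 0 \<and> (\<forall>i\<in>A. f i = 0)) \<or> sum f A \<in> K_pos"
    using assms(1,2)
  proof (induction A rule: finite_induct)
    case (insert x A)
    have IH: "(sum f A = 0 \<and> (\<forall>i\<in>A. f i = 0)) \<or> sum f A \<in> K_pos"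
      by (rule insert.IH) (use insert.prems in blast)
    have fx: "f x = 0 \<or> f x \<in> K_pos" by (rule insert.prems) simp
    have sum: "sum f (insert x A) = f x + sum f A" using insert.hyps by simp
    show ?case using IH fx K_pos_add[of "f x" "sum f A"] unfolding sum by (elim disjE conjE) simp_all
  qed simp
  then show ?thesis using assms(3) K_posD(1) by metis
qed

section \<open>Limits and first-order expansions\<close>

text \<open>The coefficient at \<open>\<mu>\<close> is constant from index \<open>N \<mu>\<close>
  on, so the limit is read off there. Below \<open>a\<close> its support lies in that of
  \<open>x (N a)\<close>, which makes it a series.\<close>

lemma puiseux_limit:
  assumes step: "\<And>n. vge (x (Suc n) - x n) (real n * \<epsilon> + c)" and "\<epsilon> > 0"
  obtains l where "\<And>n. vge (l - x n) (real n * \<epsilon> + c)"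
proof -
  have close: "vge (x m - x n) (real n * \<epsilon> + c)" if "n \<le> m" for m n
    using that
  proof (induction m rule: dec_induct)
    case (step m)
    have "vge (x (Suc m) - x m) (real n * \<epsilon> + c)"
      by (rule vge_mono[OF assms(1)]) (use step(1) \<open>\<epsilon> > 0\<close> in auto)
    then have "vge (x (Suc m) - x m + (x m - x n)) (real n * \<epsilon> + c)"
      using step.IH by (rule vge_add)
    then show ?case by simp
  qed simp
  \<comment> \<open>The \<open>+ 1\<close> turns the ceiling bound into a strict one.\<close>
  define N where "N \<mu> = nat \<lceil>(\<mu> - c) / \<epsilon>\<rceil> + 1" for \<mu>
  have N: "\<mu> < real (N \<mu>) * \<epsilon> + c" for \<mu>
  proof -
    have "(\<mu> - c) / \<epsilon> < real (N \<mu>)" unfolding N_def using real_nat_ceiling_ge[of "(\<mu> - c) / \<epsilon>"] by simp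
    then show ?thesis using \<open>\<epsilon> > 0\<close> by (simp add: field_simps)
  qed
  have same: "pcoeff (x m) \<mu> = pcoeff (x n) \<mu>"
    if "\<mu> < real n * \<epsilon> + c" "\<mu> < real m * \<epsilon> + c" for m n \<mu>
    using vge_pcoeff_eq_0[OF close, of n m \<mu>] vge_pcoeff_eq_0[OF close, of m n \<mu>] that
    by (cases "n \<le> m") auto
  define l where "l = Abs_puiseux (\<lambda>\<mu>. pcoeff (x (N \<mu>)) \<mu>)"
  have "finite ({\<mu>. pcoeff (x (N \<mu>)) \<mu> \<noteq> 0} \<inter> {..a})" for a
  proof (rule finite_subset[OF _ finite_supp[of "x (N a)" a]], rule subsetI)
    fix \<mu> assume \<mu>: "\<mu> \<in> {\<mu>. pcoeff (x (N \<mu>)) \<mu> \<noteq> 0} \<inter> {..a}"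
    then have "\<mu> < real (N a) * \<epsilon> + c" using N[of a] by auto
    then show "\<mu> \<in> supp (x (N a)) \<inter> {..a}" using \<mu> same[OF _ N[of \<mu>], of "N a"] by auto
  qed
  then have l: "pcoeff l \<mu> = pcoeff (x (N \<mu>)) \<mu>" for \<mu>
    unfolding l_def by (subst pcoeff_Abs_puiseux) auto
  have "vge (l - x n) (real n * \<epsilon> + c)" for n
    unfolding vge_def
  proof (intro allI impI, rule ccontr)
    fix \<mu> assume "pcoeff (l - x n) \<mu> \<noteq> 0" "\<not> real n * \<epsilon> + c \<le> \<mu>"
    then show False using same[of \<mu> n, OF _ N[of \<mu>]] by (simp add: l)
  qed
  then show ?thesis by (rule that)
qed

text \<open>The expansion \<open>x = 1 + y\<close> with an error of twice the order. It turns
  products into sums, and the doubled order drives Newton's method.\<close>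

definition approx :: "real \<Rightarrow> puiseux \<Rightarrow> puiseux \<Rightarrow> bool" where
  "approx e x y \<longleftrightarrow> vge y e \<and> vge (x - 1 - y) (2 * e)"

lemma approx_vge: "approx e x y \<Longrightarrow> e \<ge> 0 \<Longrightarrow> vge (x - 1) e"
  unfolding approx_def using vge_add[of y e "x - 1 - y"] vge_mono[of "x - 1 - y" "2 * e" e] by simp

lemma vge_imp_K_pos:
  assumes "vge (x - 1) e" "e > 0"
  shows "x \<in> K_pos" "leading_exponent x = 0" "lc x = 1"
proof -
  have "vge (x - 1) 0" using assms vge_mono by fastforce
  then have "vge x 0" using vge_add[OF _ vge_1[of 0], of "x - 1"] by simp
  moreover have "pcoeff x 0 = of_real 1"
    using vge_pcoeff_eq_0[OF assms] by (simp add: pcoeff_one)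
  ultimately show "x \<in> K_pos" "leading_exponent x = 0" "lc x = 1"
    using K_posI[of x 0 1] by auto
qed

lemma approx_1: "approx e 1 0"
  by (simp add: approx_def)

lemma approx_mult:
  assumes "approx e x a" "approx e y b" "e \<ge> 0"
  shows "approx e (x * y) (a + b)"
proof -
  have x: "vge (x - 1) e" and y: "vge (y - 1) e" using approx_vge assms by auto
  have "vge ((x - 1) * (y - 1)) (2 * e)" using vge_mult[OF x y] by simp
  then have "vge ((x - 1) * (y - 1) + ((x - 1 - a) + (y - 1 - b))) (2 * e)"
    using assms(1,2) unfolding approx_def by (intro vge_add) auto
  moreover have "(x - 1) * (y - 1) + ((x - 1 - a) + (y - 1 - b)) = x * y - 1 - (a + b)"
    by algebra
  ultimately have "vge (x * y - 1 - (a + b)) (2 * e)" by (simp only:)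
  then show ?thesis using assms unfolding approx_def by (auto intro: vge_add)
qed

text \<open>The error of \<open>inverse x\<close> against \<open>1 - a\<close> is
  \<open>(x - 1)^2 / x\<close> minus the error of \<open>x\<close> against
  \<open>1 + a\<close>.\<close>

lemma approx_inverse:
  assumes "approx e x a" "e > 0"
  shows "approx e (inverse x) (- a)"
proof -
  have x: "vge (x - 1) e" using approx_vge assms by auto
  note K = vge_imp_K_pos[OF x assms(2)]
  have inv: "vge (inverse x) 0"
    using K_posD(2)[OF K_pos_inverse(1)[OF K(1)]] K_pos_inverse(2)[OF K(1)] K(2) by simp
  have x0: "x \<noteq> 0" using K(1) K_posD by blast
  have "vge ((x - 1) * (x - 1) * inverse x - (x - 1 - a)) (2 * e)"
    using vge_mult[OF vge_mult[OF x x] inv] assms by (auto simp: approx_def intro!: vge_diff)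
  moreover have "(x - 1) * (x - 1) * inverse x - (x - 1 - a) = inverse x - 1 - - a"
    using x0 by (simp add: field_simps)
  ultimately show ?thesis using assms unfolding approx_def by (auto intro: vge_minus)
qed

lemma approx_powi:
  assumes "approx e x a" "e > 0"
  shows "approx e (x powi n) (of_int n * a)"
proof -
  have nat: "approx e (x ^ k) (of_nat k * a)" for k
  proof (induction k)
    case (Suc k)
    show ?case using approx_mult[OF assms(1) Suc] assms(2) by (simp add: distrib_right)
  qed (simp add: approx_1)
  show ?thesis
  proof (cases n)
    case (nonneg k)
    then show ?thesis using nat[of k] by simp
  next
    case (neg k)
    then show ?thesis using approx_inverse[OF nat[of "Suc k"] assms(2)]
      by (simp add: power_int_minus del: of_nat_Suc)
  qed
qed

lemma approx_prod:
  assumes "\<And>i. i \<in> A \<Longrightarrow> approx e (f i) (g i)" "e \<ge> 0"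
  shows "approx e (prod f A) (sum g A)"
  using assms(1) by (induction A rule: infinite_finite_induct) (simp_all add: approx_1 approx_mult assms(2))

lemma K_pos_powi:
  assumes "x \<in> K_pos"
  shows "x powi n \<in> K_pos"
proof -
  have nat: "x ^ k \<in> K_pos" for k by (induction k) (auto intro: K_pos_1 K_pos_mult assms)
  show ?thesis
    using nat K_pos_inverse(1) by (cases n) (auto simp: power_int_minus simp del: of_nat_Suc power_Suc)
qed

lemma K_pos_prod: "(\<And>i. i \<in> A \<Longrightarrow> f i \<in> K_pos) \<Longrightarrow> prod f A \<in> K_pos"
  by (induction A rule: infinite_finite_induct) (auto intro: K_pos_1 K_pos_mult)

section \<open>Monomials in torus coordinates\<close>

text \<open>The pairing extended to coefficients in a commutative ring: it occurs with real entries
  for valuations, complex ones for lowest-order parts and Puiseux ones for increments.\<close>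

definition ipair :: "int ^ 'n::finite \<Rightarrow> 'k::comm_ring_1 ^ 'n \<Rightarrow> 'k" where
  "ipair v b = (\<Sum>j\<in>UNIV. of_int (v $ j) * b $ j)"

text \<open>The character \<open>v\<close> at the torus point with coordinates
  \<open>q\<close>.\<close>

definition mon :: "puiseux ^ 'n::finite \<Rightarrow> int ^ 'n \<Rightarrow> puiseux" where
  "mon q v = (\<Prod>j\<in>UNIV. q $ j powi (v $ j))"

lemma mon_add: "(\<And>j. q $ j \<noteq> 0) \<Longrightarrow> mon q (v + w) = mon q v * mon q w"
  by (simp add: mon_def power_int_add flip: prod.distrib)

lemma mon_mult: "mon (\<chi> j. q $ j * r $ j) v = mon q v * mon r v"
  by (simp add: mon_def power_int_mult_distrib prod.distrib)

lemma mon_K_pos: "(\<And>j. q $ j \<in> K_pos) \<Longrightarrow> mon q v \<in> K_pos"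
  by (simp add: mon_def K_pos_prod K_pos_powi)

lemma mon_torus_pos: "(\<And>j. q $ j \<in> K_pos) \<Longrightarrow> mon q \<in> torus_pos"
  using K_posD(1) by (auto simp: torus_pos_def mon_K_pos intro!: mon_add)

text \<open>The linearisation of a character near the unit point, used for the Newton step and for
  the third choice of direction in \<open>torus_pos_direction\<close>.\<close>

lemma approx_mon:
  assumes "\<And>j. vge (y $ j) e" "e > 0"
  shows "approx e (mon (\<chi> j. 1 + y $ j) v) (ipair v y)"
  unfolding mon_def ipair_def using assms
  by (intro approx_prod approx_powi) (auto simp: approx_def)

lemma vge_mon:
  assumes "\<And>j. vge (q $ j - 1) e" "e > 0"
  shows "vge (mon q v - 1) e"
proof -
  have "approx e (mon (\<chi> j. 1 + (\<chi> j. q $ j - 1) $ j) v) (ipair v (\<chi> j. q $ j - 1))"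
    by (rule approx_mon) (use assms in auto)
  then show ?thesis using approx_vge[of e "mon q v"] assms(2) by (simp add: vec_lambda_eta)
qed


section \<open>Uniqueness\<close>

text \<open>The standard basis determines an additive map on the lattice. Applied to leading
  exponents and to logarithms of leading coefficients, this makes both of them linear forms.\<close>

lemma additive_int_vec:
  fixes f :: "int ^ 'n::finite \<Rightarrow> 'k::comm_ring_1"
  assumes add: "\<And>v w. f (v + w) = f v + f w"
  shows "f v = ipair v (\<chi> j. f (axis j 1))"
proof -
  have f0: "f 0 = 0" using add[of 0 0] by simp
  have scale: "f (n *s w) = of_int n * f w" for n w
  proof (induction n rule: int_induct[where k = 0])
    case base
    show ?case by (simp add: f0)
  next
    case (step1 i)
    then show ?case using add[of "i *s w" w] by (simp add: vector_sadd_rdistrib algebra_simps)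
  next
    case (step2 i)
    have "i *s w = (i - 1) *s w + w" by (simp add: vec_eq_iff algebra_simps)
    then show ?case using add[of "(i - 1) *s w" w] step2 by (simp add: algebra_simps)
  qed
  have "f (sum g S) = (\<Sum>x\<in>S. f (g x))" if "finite S" for g and S :: "'n set"
    using that by induction (simp_all add: f0 add)
  then have "f (\<Sum>j\<in>UNIV. (v $ j) *s axis j 1) = (\<Sum>j\<in>UNIV. of_int (v $ j) * f (axis j 1))"
    by (simp add: scale)
  then show ?thesis by (simp add: basis_expansion ipair_def)
qed

lemma torus_pos_eq_mon:
  assumes "p \<in> torus_pos"
  shows "p v = mon (\<chi> j. p (axis j 1)) v"
proof -
  have nz: "p v \<noteq> 0" and add: "p (v + w) = p v * p w" for v w
    using assms K_posD(1) by (auto simp: torus_pos_def)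
  have p0: "p 0 = 1" using add[of 0 0] nz[of 0] by simp
  have scale: "p (n *s w) = p w powi n" for n w
  proof (induction n rule: int_induct[where k = 0])
    case base
    show ?case by (simp add: p0)
  next
    case (step1 i)
    then show ?case using add[of "i *s w" w] nz[of w]
      by (simp add: vector_sadd_rdistrib power_int_add)
  next
    case (step2 i)
    have "i *s w = (i - 1) *s w + w" by (simp add: vec_eq_iff algebra_simps)
    then show ?case using add[of "(i - 1) *s w" w] step2 nz[of w]
      by (simp add: power_int_diff field_simps)
  qed
  have "p (sum g S) = (\<Prod>x\<in>S. p (g x))" if "finite S" for g and S :: "'a set"
    using that by induction (simp_all add: p0 add)
  then have "p (\<Sum>j\<in>UNIV. (v $ j) *s axis j 1) = (\<Prod>j\<in>UNIV. p (axis j 1) powi (v $ j))"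
    by (simp add: scale)
  then show ?thesis by (simp add: basis_expansion mon_def)
qed

lemma torus_pos_mult:
  assumes "p \<in> torus_pos" "q \<in> torus_pos"
  shows "(\<lambda>v. p v * q v) \<in> torus_pos"
  using assms K_pos_mult(1) by (auto simp: torus_pos_def mult_ac)

lemma torus_pos_inverse:
  assumes "p \<in> torus_pos"
  shows "(\<lambda>v. inverse (p v)) \<in> torus_pos"
  using assms K_pos_inverse(1) by (auto simp: torus_pos_def)

lemma ipair_of_real: "ipair v (\<chi> j. of_real (u $ j)) = of_real (ipair v u)"
  by (simp add: ipair_def)

lemma ipair_cnj: "ipair v (\<chi> j. cnj (b $ j)) = cnj (ipair v b)"
  by (simp add: ipair_def)

lemma ipair_minus: "ipair v (- b) = - ipair v b"
  by (simp add: ipair_def sum_negf)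

lemma cst_ipair: "cst (ipair v b) = ipair v (\<chi> j. cst (b $ j))"
  by (simp add: ipair_def cst_sum)

lemma pcoeff_ipair: "pcoeff (ipair v y) e = ipair v (\<chi> j. pcoeff (y $ j) e)"
  by (simp add: ipair_def pcoeff_sum)

lemma vge_ipair: "(\<And>j. vge (y $ j) e) \<Longrightarrow> vge (ipair v y) e"
  unfolding ipair_def by (intro vge_sum vge_of_int_mult)

lemma vec_lowest_order:
  fixes y :: "puiseux ^ 'n::finite"
  assumes "y \<noteq> 0"
  obtains s k where "\<And>j. vge (y $ j) s" "pcoeff (y $ k) s \<noteq> 0"
proof -
  define J where "J = {j. y $ j \<noteq> 0}"
  have "J \<noteq> {}" using assms by (auto simp: J_def vec_eq_iff)
  define s where "s = Min ((\<lambda>j. leading_exponent (y $ j)) ` J)"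
  have "s \<in> (\<lambda>j. leading_exponent (y $ j)) ` J"
    unfolding s_def using \<open>J \<noteq> {}\<close> by (intro Min_in) auto
  then obtain k where k: "k \<in> J" "s = leading_exponent (y $ k)" by auto
  have "vge (y $ j) s" for j
  proof (cases "j \<in> J")
    case True
    then have "s \<le> leading_exponent (y $ j)" unfolding s_def by (intro Min_le) auto
    then show ?thesis using vge_leading_exponent[of "y $ j"] True vge_mono by (auto simp: J_def)
  qed (simp add: J_def)
  moreover have "pcoeff (y $ k) s \<noteq> 0" using k leading_exponent(1)[of "y $ k"] by (simp add: J_def)
  ultimately show ?thesis by (rule that)
qed

lemma K_pos_cst_mult:
  assumes "vge x e" "c * pcoeff x e = of_real r" "r > 0"
  shows "cst c * x \<in> K_pos"
  using assms by (intro K_posI[of _ e r]) (auto simp: vge_def)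

text \<open>
  A direction \<open>b\<close> along which a non-trivial \<open>q\<close> grows: minus its valuation if that is not zero,
  else the logarithm of its leading coefficients, else the lowest-order part of \<open>q - 1\<close>.
\<close>

lemma torus_pos_direction:
  fixes q :: "int ^ 'n::finite \<Rightarrow> puiseux"
  assumes q: "q \<in> torus_pos" and "q \<noteq> (\<lambda>v. 1)"
  obtains b :: "complex ^ 'n" where "b \<noteq> 0"
    "\<And>v. ipair v b \<noteq> 0 \<Longrightarrow> cst (cnj (ipair v b)) * (q v - 1) \<in> K_pos"
proof -
  have K: "q v \<in> K_pos" for v using q by (simp add: torus_pos_def)
  note Kq = K_posD[OF K]
  have q_add: "q (v + w) = q v * q w" for v w using q by (simp add: torus_pos_def)
  define \<nu> :: "real ^ 'n" where "\<nu> = (\<chi> j. leading_exponent (q (axis j 1)))"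
  define \<kappa> :: "real ^ 'n" where "\<kappa> = (\<chi> j. ln (lc (q (axis j 1))))"
  have \<nu>: "leading_exponent (q v) = ipair v \<nu>" for v
    unfolding \<nu>_def by (rule additive_int_vec) (simp add: q_add K_pos_mult(2)[OF K K])
  have \<kappa>: "ln (lc (q v)) = ipair v \<kappa>" for v
    unfolding \<kappa>_def by (rule additive_int_vec) (simp add: q_add K_pos_mult(3)[OF K K] ln_mult_pos Kq(4))
  consider "\<nu> \<noteq> 0" | "\<nu> = 0" "\<kappa> \<noteq> 0" | "\<nu> = 0" "\<kappa> = 0" by blast
  then show ?thesis
  proof cases
    case 1
    define b where "b = (\<chi> j. complex_of_real ((- \<nu>) $ j))"
    have b: "ipair v b = of_real (- ipair v \<nu>)" for v
      unfolding b_def by (subst ipair_of_real) (simp only: ipair_minus)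
    show ?thesis
    proof (rule that[of b])
      show "b \<noteq> 0" using 1 by (auto simp: b_def vec_eq_iff)
      fix v assume nz: "ipair v b \<noteq> 0"
      let ?m = "ipair v \<nu>"
      have qv: "vge (q v) ?m" "pcoeff (q v) ?m = of_real (lc (q v))" using Kq(2,3)[of v] by (auto simp: \<nu>)
      \<comment> \<open>For positive valuation \<open>q v - 1\<close> starts with \<open>-1\<close>,
        for negative valuation with the positive leading coefficient of \<open>q v\<close>. The
        pairing with \<open>b\<close> has the sign opposite to the valuation, so the product starts
        positively in both cases.\<close>
      consider "?m > 0" | "?m < 0" using nz unfolding b by fastforce
      then show "cst (cnj (ipair v b)) * (q v - 1) \<in> K_pos"
      proof cases
        case 1
        show ?thesis
        proof (rule K_pos_cst_mult[of _ 0 _ "?m"])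
          show "vge (q v - 1) 0" using vge_mono[OF qv(1)] 1 by (intro vge_diff vge_1) auto
          show "cnj (ipair v b) * pcoeff (q v - 1) 0 = of_real ?m"
            using vge_pcoeff_eq_0[OF qv(1) 1] by (simp add: b pcoeff_one)
        qed fact
      next
        case 2
        show ?thesis
        proof (rule K_pos_cst_mult[of _ ?m _ "- ?m * lc (q v)"])
          show "vge (q v - 1) ?m" using qv(1) 2 by (intro vge_diff vge_1) auto
          show "cnj (ipair v b) * pcoeff (q v - 1) ?m = of_real (- ?m * lc (q v))"
            using qv(2) 2 by (simp add: b pcoeff_one)
          show "- ?m * lc (q v) > 0" using 2 Kq(4)[of v] by (simp add: mult_neg_pos)
        qed
      qed
    qed
  next
    case 2
    define b where "b = (\<chi> j. complex_of_real (\<kappa> $ j))"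
    have b: "ipair v b = of_real (ipair v \<kappa>)" for v unfolding b_def by (rule ipair_of_real)
    show ?thesis
    proof (rule that[of b])
      show "b \<noteq> 0" using 2 by (auto simp: b_def vec_eq_iff)
      fix v assume nz: "ipair v b \<noteq> 0"
      let ?L = "lc (q v)"
      have qv: "vge (q v) 0" "pcoeff (q v) 0 = of_real ?L"
        using Kq(2,3)[of v] 2 by (auto simp: \<nu> ipair_def)
      have L: "?L > 0" "ln ?L \<noteq> 0" using Kq(4)[of v] nz by (auto simp: b \<kappa>)
      show "cst (cnj (ipair v b)) * (q v - 1) \<in> K_pos"
      proof (rule K_pos_cst_mult)
        show "vge (q v - 1) 0" using qv(1) by (intro vge_diff vge_1) auto
        show "cnj (ipair v b) * pcoeff (q v - 1) 0 = of_real (ln ?L * (?L - 1))"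
          using qv(2) by (simp add: b \<kappa> pcoeff_one)
        \<comment> \<open>\<open>ln ?L\<close> and \<open>?L - 1\<close> have the same sign.\<close>
        show "ln ?L * (?L - 1) > 0"
          using L by (cases "?L < 1") (auto intro: mult_neg_neg mult_pos_pos)
      qed
    qed
  next
    case 3
    define y where "y = (\<chi> j. q (axis j 1) - 1)"
    have le0: "leading_exponent (q v) = 0" for v using 3 by (simp add: \<nu> ipair_def)
    have "lc (q v) = 1" for v
      using 3 \<kappa>[of v] Kq(4)[of v] by (simp add: ipair_def)
    then have y0: "vge (y $ j) 0" "pcoeff (y $ j) 0 = 0" for j
      using Kq(2,3)[of "axis j 1"] by (auto simp: y_def le0 pcoeff_one intro!: vge_diff vge_1)
    have q_mon: "q v = mon (\<chi> j. 1 + y $ j) v" for v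
      using torus_pos_eq_mon[OF q, of v] by (simp add: y_def)
    have "y \<noteq> 0"
    proof
      assume "y = 0"
      then have "q v = 1" for v unfolding q_mon by (simp add: mon_def)
      then show False using \<open>q \<noteq> (\<lambda>v. 1)\<close> by auto
    qed
    then obtain s k where ys: "\<And>j. vge (y $ j) s" and yk: "pcoeff (y $ k) s \<noteq> 0"
      using vec_lowest_order by blast
    have "0 \<le> s" using y0(1)[of k] yk by (simp add: vge_def)
    moreover have "s \<noteq> 0" using yk y0(2)[of k] by metis
    ultimately have "s > 0" by simp
    define b where "b = (\<chi> j. pcoeff (y $ j) s)"
    show ?thesis
    proof (rule that[of b])
      show "b \<noteq> 0" using yk by (auto simp: b_def vec_eq_iff)
      fix v assume nz: "ipair v b \<noteq> 0"
      have ap: "approx s (q v) (ipair v y)" unfolding q_mon using ys \<open>s > 0\<close> by (rule approx_mon)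
      \<comment> \<open>The expansion error has order \<open>2 * s > s\<close>, so at exponent
        \<open>s\<close> only the linear part counts; times its conjugate it gives a squared
        modulus.\<close>
      have "pcoeff (q v - 1 - ipair v y) s = 0"
        by (rule vge_pcoeff_eq_0[of _ "2 * s"]) (use ap \<open>s > 0\<close> in \<open>auto simp: approx_def\<close>)
      then have c: "pcoeff (q v - 1) s = ipair v b" by (simp add: pcoeff_ipair b_def)
      show "cst (cnj (ipair v b)) * (q v - 1) \<in> K_pos"
      proof (rule K_pos_cst_mult)
        show "vge (q v - 1) s" using approx_vge[OF ap] \<open>s > 0\<close> by simp
        show "cnj (ipair v b) * pcoeff (q v - 1) s = of_real ((cmod (ipair v b))\<^sup>2)"
          unfolding c complex_norm_square by (rule mult.commute)
        show "(cmod (ipair v b))\<^sup>2 > 0" using nz by simp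
      qed
    qed
  qed
qed

section \<open>Critical equations and their pairings\<close>

text \<open>By linearity the coordinate equations can be paired with any vector over the ring, in
  particular with the conjugate of a complex vector, read as constant series.\<close>

lemma weighted_sum_ipair:
  assumes "\<And>j. (\<Sum>v\<in>A. w v * of_int (v $ j)) = 0"
  shows "(\<Sum>v\<in>A. w v * ipair v c) = (0 :: 'k::comm_ring_1)"
proof -
  have "(\<Sum>v\<in>A. w v * ipair v c) = (\<Sum>v\<in>A. \<Sum>j\<in>UNIV. c $ j * (w v * of_int (v $ j)))"
    unfolding ipair_def sum_distrib_left by (intro sum.cong refl) (simp add: mult_ac)
  also have "\<dots> = (\<Sum>j\<in>UNIV. c $ j * (\<Sum>v\<in>A. w v * of_int (v $ j)))"
    unfolding sum_distrib_left by (rule sum.swap)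
  finally show ?thesis by (simp add: assms)
qed

lemma critical_point_iff:
  "critical_point W p \<longleftrightarrow>
     (\<forall>j. (\<Sum>v\<in>Poly_Mapping.keys W. Poly_Mapping.lookup W v * p v * of_int (v $ j)) = 0)"
proof
  assume *: "critical_point W p"
  have "pairing v (axis j 1) = v $ j" for v :: "int ^ 'a" and j
    by (simp add: pairing_def axis_def if_distrib cong: if_cong)
  then show "\<forall>j. (\<Sum>v\<in>Poly_Mapping.keys W. Poly_Mapping.lookup W v * p v * of_int (v $ j)) = 0"
    using *[unfolded critical_point_def, rule_format, of "axis _ 1"] by (simp add: mult_ac)
next
  assume *: "\<forall>j. (\<Sum>v\<in>Poly_Mapping.keys W. Poly_Mapping.lookup W v * p v * of_int (v $ j)) = 0"
  have "of_int (pairing v u) = (ipair v (\<chi> j. of_int (u $ j)) :: puiseux)" for v u :: "int ^ 'a"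
    by (simp add: pairing_def ipair_def)
  then show "critical_point W p"
    using weighted_sum_ipair[of "\<lambda>v. Poly_Mapping.lookup W v * p v"] * 
    by (simp add: critical_point_def mult_ac)
qed

lemma positive_critical_point_unique:
  fixes \<gamma> :: "int ^ 'n::finite \<Rightarrow> puiseux"
  assumes "finite A" and \<gamma>: "\<And>v. v \<in> A \<Longrightarrow> \<gamma> v \<in> K_pos"
    and ndeg: "\<And>b :: complex ^ 'n. (\<And>v. v \<in> A \<Longrightarrow> ipair v b = 0) \<Longrightarrow> b = 0"
    and p: "p \<in> torus_pos" "\<And>j. (\<Sum>v\<in>A. \<gamma> v * p v * of_int (v $ j)) = 0"
    and p': "p' \<in> torus_pos" "\<And>j. (\<Sum>v\<in>A. \<gamma> v * p' v * of_int (v $ j)) = 0"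
  shows "p' = p"
proof -
  define q where "q v = p' v * inverse (p v)" for v
  have q: "q \<in> torus_pos"
    unfolding q_def using torus_pos_mult[OF p'(1) torus_pos_inverse[OF p(1)]] .
  have nz: "p v \<noteq> 0" for v using p(1) K_posD(1) by (auto simp: torus_pos_def)
  have p'_eq: "p' v = p v * q v" for v using nz by (simp add: q_def)
  have "q = (\<lambda>v. 1)"
  proof (rule ccontr)
    assume "q \<noteq> (\<lambda>v. 1)"
    then obtain b :: "complex ^ 'n" where b: "b \<noteq> 0"
      "\<And>v. ipair v b \<noteq> 0 \<Longrightarrow> cst (cnj (ipair v b)) * (q v - 1) \<in> K_pos"
      using torus_pos_direction[OF q] by blast
    \<comment> \<open>The summands of the difference of the two critical equations, paired with the
      conjugate of \<open>b\<close>.\<close>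
    define f where "f v = \<gamma> v * p v * (cst (cnj (ipair v b)) * (q v - 1))" for v
    have pK: "p v \<in> K_pos" for v using p(1) by (simp add: torus_pos_def)
    have pos: "f v \<in> K_pos" if "v \<in> A" "ipair v b \<noteq> 0" for v
      unfolding f_def by (intro K_pos_mult(1) \<gamma> pK b(2) that)
    have f0: "f v = 0" if "ipair v b = 0" for v using that by (simp add: f_def)
    let ?c = "\<chi> j. cst (cnj (b $ j))"
    have c: "cst (cnj (ipair v b)) = ipair v ?c" for v
      by (simp add: cst_ipair flip: ipair_cnj)
    have "sum f A = (\<Sum>v\<in>A. \<gamma> v * p' v * ipair v ?c) - (\<Sum>v\<in>A. \<gamma> v * p v * ipair v ?c)"
      unfolding f_def c p'_eq by (simp add: algebra_simps flip: sum_subtractf)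
    also have "\<dots> = 0" using weighted_sum_ipair[OF p(2)] weighted_sum_ipair[OF p'(2)] by simp
    finally have "sum f A = 0" .
    with \<open>finite A\<close> have "\<forall>v\<in>A. f v = 0" by (intro K_pos_sum_eq_0) (use pos f0 in auto)
    then have "ipair v b = 0" if "v \<in> A" for v using that pos K_posD(1) by blast
    then show False using ndeg b(1) by blast
  qed
  then show ?thesis using p'_eq by auto
qed

lemma positive_critical_point_not_unique:
  fixes \<gamma> :: "int ^ 'n::finite \<Rightarrow> puiseux" and u :: "real ^ 'n"
  assumes "finite A" and \<gamma>: "\<And>v. v \<in> A \<Longrightarrow> \<gamma> v \<in> K_pos"
    and u: "u \<noteq> 0" "\<And>v. v \<in> A \<Longrightarrow> ipair v u \<ge> 0"
    and p: "p \<in> torus_pos" "\<And>j. (\<Sum>v\<in>A. \<gamma> v * p v * of_int (v $ j)) = 0"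
  obtains p' where "p' \<in> torus_pos" "\<And>j. (\<Sum>v\<in>A. \<gamma> v * p' v * of_int (v $ j)) = 0" "p' \<noteq> p"
proof -
  have pK: "p v \<in> K_pos" for v using p(1) by (simp add: torus_pos_def)
  define f where "f v = \<gamma> v * p v * cst (of_real (ipair v u))" for v
  have cK: "cst (of_real r) \<in> K_pos" if "r > 0" for r
    using K_pos_monomial[OF that] by (simp add: cst_def)
  have pos: "f v \<in> K_pos" if "v \<in> A" "ipair v u \<noteq> 0" for v
    unfolding f_def using u(2)[OF that(1)] that(2) by (intro K_pos_mult(1) \<gamma> pK cK that) auto
  have f0: "f v = 0" if "ipair v u = 0" for v using that by (simp add: f_def)
  have "cst (of_real (ipair v u)) = ipair v (\<chi> j. cst (of_real (u $ j)))" for v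
    by (simp add: cst_ipair flip: ipair_of_real)
  then have "sum f A = 0" using weighted_sum_ipair[OF p(2)] by (simp add: f_def)
  with \<open>finite A\<close> have "\<forall>v\<in>A. f v = 0"
    by (intro K_pos_sum_eq_0) (use pos f0 in auto)
  then have perp: "ipair v u = 0" if "v \<in> A" for v using that pos K_posD(1) by blast
  \<comment> \<open>The point \<open>t\<close> to the power \<open>u\<close>, with real exponents.
    It takes the value \<open>1\<close> on \<open>A\<close>, so multiplying by it keeps the critical
    equations.\<close>
  define h where "h v = monomial (of_real 1) (ipair v u)" for v
  have h: "h \<in> torus_pos"
    unfolding torus_pos_def h_def
    by (auto simp: monomial_mult K_pos_monomial[of 1, simplified] ipair_def distrib_right sum.distrib)
  have h1: "h v = 1" if "v \<in> A" for v
    using perp[OF that] by (simp add: h_def flip: cst_def)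
  show ?thesis
  proof
    show "(\<lambda>v. p v * h v) \<in> torus_pos" using torus_pos_mult[OF p(1) h] .
    show "(\<Sum>v\<in>A. \<gamma> v * (p v * h v) * of_int (v $ j)) = 0" for j
      using p(2)[of j] h1 by (simp cong: sum.cong)
    show "(\<lambda>v. p v * h v) \<noteq> p"
    proof
      assume eq: "(\<lambda>v. p v * h v) = p"
      obtain j where j: "u $ j \<noteq> 0" using u(1) by (auto simp: vec_eq_iff)
      have "p (axis j 1) * h (axis j 1) = p (axis j 1)" using fun_cong[OF eq, of "axis j 1"] by simp
      then have "h (axis j 1) = 1" using K_posD(1)[OF pK[of "axis j 1"]] by simp
      moreover have "ipair (axis j 1) u = u $ j"
        by (simp add: ipair_def axis_def if_distrib if_distribR cong: if_cong)
      ultimately have "pcoeff (monomial 1 (u $ j)) 0 = 1"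
        by (simp add: h_def pcoeff_one)
      then show False using j by (simp add: pcoeff_monomial)
    qed
  qed
qed


section \<open>Existence by Newton's method\<close>

text \<open>
  Says that the vector \<open>\<Sum>v\<in>A. x v * v\<close> has its coefficient at exponent
  \<open>\<mu>\<close> in the complex span of the \<open>v\<close> with \<open>D v + e \<le> \<mu>\<close>, phrased through the annihilators \<open>b\<close> of that span.
\<close>

definition residual_ge :: "(int ^ 'n::finite) set \<Rightarrow> (int ^ 'n \<Rightarrow> real) \<Rightarrow> real \<Rightarrow> (int ^ 'n \<Rightarrow> puiseux) \<Rightarrow> bool" where
  "residual_ge A D e x \<longleftrightarrow> (\<forall>(b :: complex ^ 'n) \<mu>. (\<forall>v\<in>A. D v + e \<le> \<mu> \<longrightarrow> ipair v b = 0) \<longrightarrow>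
     (\<Sum>v\<in>A. pcoeff (x v) \<mu> * ipair v b) = 0)"

text \<open>A summand with a non-zero coefficient at \<open>\<mu>\<close> has
  \<open>D v + e \<le> \<mu>\<close>, so the annihilator kills it.\<close>

lemma residual_ge_vge:
  assumes "\<And>v. v \<in> A \<Longrightarrow> vge (x v) (D v + e)"
  shows "residual_ge A D e x"
  unfolding residual_ge_def using assms by (fastforce simp: vge_def intro!: sum.neutral)

lemma residual_ge_add:
  "residual_ge A D e x \<Longrightarrow> residual_ge A D e y \<Longrightarrow> residual_ge A D e (\<lambda>v. x v + y v)"
  by (simp add: residual_ge_def distrib_right sum.distrib)

text \<open>The change \<open>w v * (z v - 1)\<close> has valuation at least
  \<open>D v + e\<close>.\<close>

lemma residual_ge_unit_mult:
  assumes "residual_ge A D e w" "\<And>v. v \<in> A \<Longrightarrow> vge (w v) (D v)" "\<And>v. v \<in> A \<Longrightarrow> vge (z v - 1) e"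
  shows "residual_ge A D e (\<lambda>v. w v * z v)"
proof -
  have "residual_ge A D e (\<lambda>v. w v * (z v - 1))"
    by (intro residual_ge_vge vge_mult assms)
  from residual_ge_add[OF assms(1) this] show ?thesis by (simp add: algebra_simps)
qed

lemma pcoeff_weighted_sum_cst:
  "pcoeff (\<Sum>v\<in>A. x v * cst (ipair v b)) \<mu> = (\<Sum>v\<in>A. pcoeff (x v) \<mu> * ipair v b)"
  by (simp add: pcoeff_sum)

text \<open>For large \<open>k\<close> the exponent \<open>\<mu>\<close> lies below all
  \<open>D v + real k * \<epsilon>\<close>; every vector is then an annihilator, those of the
  standard basis included.\<close>

lemma residual_ge_eq_0:
  assumes "finite A" and r: "\<And>k::nat. residual_ge A D (real k * \<epsilon>) x" and "\<epsilon> > 0"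
  shows "(\<Sum>v\<in>A. x v * of_int (v $ j)) = 0"
proof (rule puiseux_eqI)
  fix \<mu>
  define C where "C = (\<Sum>v\<in>A. \<bar>D v\<bar>) + \<bar>\<mu>\<bar>"
  obtain k :: nat where k: "C < real k * \<epsilon>" using \<open>\<epsilon> > 0\<close> reals_Archimedean3 by blast
  have far: "\<mu> < D v + real k * \<epsilon>" if "v \<in> A" for v
  proof -
    have "\<bar>D v\<bar> \<le> (\<Sum>v\<in>A. \<bar>D v\<bar>)" by (rule member_le_sum) (use that assms in auto)
    then show ?thesis using k unfolding C_def by linarith
  qed
  have pair: "ipair v (axis j 1) = (of_int (v $ j) :: complex)" for v
    by (simp add: ipair_def axis_def if_distrib cong: if_cong)
  have "(\<Sum>v\<in>A. pcoeff (x v) \<mu> * ipair v (axis j 1)) = 0"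
    using r[of k, unfolded residual_ge_def, rule_format, of \<mu> "axis j 1"] far by force
  then have "pcoeff (\<Sum>v\<in>A. x v * cst (ipair v (axis j 1))) \<mu> = 0"
    by (simp only: pcoeff_weighted_sum_cst)
  then show "pcoeff (\<Sum>v\<in>A. x v * of_int (v $ j)) \<mu> = pcoeff 0 \<mu>" by (simp add: pair)
qed

text \<open>Discreteness of the supports opens a gap: an occurring exponent above \<open>D v\<close>
  is at least \<open>D v + \<epsilon>\<close>. At such a \<open>\<mu>\<close> the annihilators
  therefore kill all levels below \<open>\<mu>\<close>, and \<open>lead\<close> applies.\<close>

lemma residual_ge_initial:
  assumes "finite A" and w: "\<And>v. v \<in> A \<Longrightarrow> vge (w v) (D v)"
    and lead: "\<forall>s (b :: complex ^ 'n::finite). (\<forall>v\<in>A. D v < s \<longrightarrow> ipair v b = 0) \<longrightarrow>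
      (\<Sum>v | v \<in> A \<and> D v = s. pcoeff (w v) s * ipair v b) = 0"
  shows "\<exists>\<epsilon>>0. residual_ge A D \<epsilon> w"
proof -
  \<comment> \<open>The offsets of exponents from levels, cut off at \<open>1\<close> to keep the
    set finite; \<open>\<epsilon>\<close> is the least positive one, or \<open>1\<close>.\<close>
  define S where "S = (\<Union>v\<in>A. \<Union>v'\<in>A. (\<lambda>\<mu>. \<mu> - D v) ` (supp (w v') \<inter> {..D v + 1}))"
  define \<epsilon> where "\<epsilon> = Min (insert 1 (S \<inter> {0<..}))"
  have fin: "finite (insert 1 (S \<inter> {0<..}))"
    unfolding S_def using assms(1) finite_supp by (intro finite.insertI finite_Int) auto
  have pos: "\<epsilon> > 0" unfolding \<epsilon>_def by (subst Min_gr_iff[OF fin]) auto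
  have small: "\<epsilon> \<le> x" if "x \<in> S" "x > 0" for x
    unfolding \<epsilon>_def using that fin by (intro Min_le) auto
  have "\<epsilon> \<le> 1" unfolding \<epsilon>_def using fin by (intro Min_le) auto
  have gap: "D v + \<epsilon> \<le> \<mu>" if "v \<in> A" "v' \<in> A" "pcoeff (w v') \<mu> \<noteq> 0" "D v < \<mu>" for v v' \<mu>
  proof (cases "\<mu> \<le> D v + 1")
    case True
    then have "\<mu> - D v \<in> S" unfolding S_def using that by blast
    then show ?thesis using small[of "\<mu> - D v"] that(4) by simp
  qed (use \<open>\<epsilon> \<le> 1\<close> in simp)
  have "residual_ge A D \<epsilon> w"
    unfolding residual_ge_def
  proof (intro allI impI)
    fix b :: "complex ^ 'n" and \<mu>
    assume b: "\<forall>v\<in>A. D v + \<epsilon> \<le> \<mu> \<longrightarrow> ipair v b = 0"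
    show "(\<Sum>v\<in>A. pcoeff (w v) \<mu> * ipair v b) = 0"
    proof (cases "\<exists>v'\<in>A. pcoeff (w v') \<mu> \<noteq> 0")
      case True
      then have low: "ipair v b = 0" if "v \<in> A" "D v < \<mu>" for v using b gap that by blast
      have "(\<Sum>v\<in>A. pcoeff (w v) \<mu> * ipair v b) = (\<Sum>v | v \<in> A \<and> D v = \<mu>. pcoeff (w v) \<mu> * ipair v b)"
      proof (rule sum.mono_neutral_right)
        show "\<forall>v\<in>A - {v \<in> A. D v = \<mu>}. pcoeff (w v) \<mu> * ipair v b = 0"
        proof
          fix v assume v: "v \<in> A - {v \<in> A. D v = \<mu>}"
          then consider "D v < \<mu>" | "\<mu> < D v" by fastforce
          then show "pcoeff (w v) \<mu> * ipair v b = 0"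
            using v low vge_pcoeff_eq_0[OF w] by cases auto
        qed
      qed (use assms(1) in auto)
      also have "\<dots> = 0" using lead low by blast
      finally show ?thesis .
    qed (simp add: sum.neutral)
  qed
  then show ?thesis using pos by blast
qed

section \<open>The Hessian and the Newton iteration\<close>

text \<open>The levels \<open>D\<close> are fixed for the whole iteration: Newton corrections
  multiply the weights by series \<open>1 + y\<close> with \<open>y\<close> of positive order, which
  keeps leading exponents.\<close>

locale leading_weights =
  fixes A :: "(int ^ 'n::finite) set" and D :: "int ^ 'n \<Rightarrow> real"
  assumes fin: "finite A"
    and ndeg: "\<And>b :: complex ^ 'n. (\<And>v. v \<in> A \<Longrightarrow> ipair v b = 0) \<Longrightarrow> b = 0"
begin

definition weights :: "(int ^ 'n \<Rightarrow> puiseux) \<Rightarrow> bool" where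
  "weights w \<longleftrightarrow> (\<forall>v\<in>A. w v \<in> K_pos \<and> leading_exponent (w v) = D v)"

lemma weights_vge: "weights w \<Longrightarrow> v \<in> A \<Longrightarrow> vge (w v) (D v)"
  using K_posD(2) by (metis weights_def)

lemma weights_mult_unit:
  assumes "weights w" "\<And>v. v \<in> A \<Longrightarrow> vge (z v - 1) e" "e > 0"
  shows "weights (\<lambda>v. w v * z v)"
  unfolding weights_def
proof
  fix v assume v: "v \<in> A"
  note z = vge_imp_K_pos[OF assms(2)[OF v] assms(3)]
  have "w v \<in> K_pos" "leading_exponent (w v) = D v" using assms(1) v by (auto simp: weights_def)
  then show "w v * z v \<in> K_pos \<and> leading_exponent (w v * z v) = D v"
    using K_pos_mult(1,2)[of "w v" "z v"] z by simp
qed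

text \<open>
  The form \<open>H y = \<Sum>v\<in>A. w v * ipair v y * v\<close> paired with the conjugate of the lowest-order part of \<open>y\<close>
  is positive definite.
\<close>

lemma hessian_lower_bound:
  fixes y :: "puiseux ^ 'n"
  assumes w: "weights w" and y: "y \<noteq> 0"
  obtains b :: "complex ^ 'n" and s \<mu> where "\<And>j. vge (y $ j) s"
    "\<And>v. v \<in> A \<Longrightarrow> D v < \<mu> \<Longrightarrow> ipair v b = 0"
    "pcoeff (\<Sum>v\<in>A. w v * ipair v y * cst (ipair v b)) (\<mu> + s) \<noteq> 0"
proof -
  obtain s k where ys: "\<And>j. vge (y $ j) s" and yk: "pcoeff (y $ k) s \<noteq> 0"
    using vec_lowest_order[OF y] by blast
  define c where "c = (\<chi> j. pcoeff (y $ j) s)"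
  define b where "b = (\<chi> j. cnj (c $ j))"
  have bc: "ipair v b = cnj (ipair v c)" for v unfolding b_def by (rule ipair_cnj)
  have "c \<noteq> 0" using yk by (auto simp: c_def vec_eq_iff)
  define N where "N = {v \<in> A. ipair v c \<noteq> 0}"
  have "N \<noteq> {}" using ndeg[of c] \<open>c \<noteq> 0\<close> by (auto simp: N_def)
  have finN: "finite N" using fin by (simp add: N_def)
  \<comment> \<open>The lowest level not annihilated by \<open>c\<close>. After pairing with
    \<open>b\<close>, only terms of this level contribute at exponent \<open>\<mu> + s\<close>, each
    with a positive leading coefficient times a squared modulus.\<close>
  define \<mu> where "\<mu> = Min (D ` N)"
  have "\<mu> \<in> D ` N" unfolding \<mu>_def using \<open>N \<noteq> {}\<close> finN by (intro Min_in) auto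
  then obtain v0 where v0: "v0 \<in> N" "D v0 = \<mu>" by auto
  have N\<mu>: "\<mu> \<le> D v" if "v \<in> N" for v unfolding \<mu>_def using that finN by (intro Min_le) auto
  define \<phi> where "\<phi> v = (if v \<in> N \<and> D v = \<mu> then lc (w v) * (cmod (ipair v c))\<^sup>2 else 0)" for v
  have lcpos: "lc (w v) > 0" if "v \<in> A" for v using w that K_posD(4) by (simp add: weights_def)
  have summand: "pcoeff (w v * ipair v y) (\<mu> + s) * ipair v b = of_real (\<phi> v)" if v: "v \<in> A" for v
  proof (cases "v \<in> N")
    case False
    then show ?thesis using v by (simp add: \<phi>_def N_def bc)
  next
    case True
    show ?thesis
    proof (cases "D v = \<mu>")
      case True
      have "pcoeff (w v * ipair v y) (\<mu> + s) = pcoeff (w v) \<mu> * pcoeff (ipair v y) s"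
        using weights_vge[OF w v] vge_ipair[OF ys] by (intro pcoeff_mult_bottom) (auto simp: True)
      moreover have "pcoeff (w v) \<mu> = of_real (lc (w v))"
        using w v True K_posD(3) by (metis weights_def)
      moreover have "pcoeff (ipair v y) s = ipair v c" by (simp add: pcoeff_ipair c_def)
      moreover have "\<phi> v = lc (w v) * (cmod (ipair v c))\<^sup>2" using \<open>v \<in> N\<close> True by (simp add: \<phi>_def)
      ultimately show ?thesis by (simp only: bc of_real_mult complex_norm_square mult.assoc)
    next
      case False
      then have "\<mu> < D v" using N\<mu>[OF \<open>v \<in> N\<close>] by simp
      then have "pcoeff (w v * ipair v y) (\<mu> + s) = 0"
        by (intro vge_pcoeff_eq_0[OF vge_mult[OF weights_vge[OF w v] vge_ipair[OF ys]]]) auto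
      then show ?thesis using False by (simp add: \<phi>_def)
    qed
  qed
  show ?thesis
  proof (rule that[OF ys])
    show "ipair v b = 0" if "v \<in> A" "D v < \<mu>" for v
      using that N\<mu>[of v] by (auto simp: N_def bc)
    have "sum \<phi> A > 0"
    proof (rule sum_pos2[OF fin])
      show "v0 \<in> A" using v0 by (simp add: N_def)
      then show "\<phi> v0 > 0" using v0 lcpos by (simp add: \<phi>_def N_def)
      show "\<phi> v \<ge> 0" if "v \<in> A" for v using lcpos[OF that] by (simp add: \<phi>_def)
    qed
    moreover have "pcoeff (\<Sum>v\<in>A. w v * ipair v y * cst (ipair v b)) (\<mu> + s) = of_real (sum \<phi> A)"
      unfolding pcoeff_weighted_sum_cst using summand by simp
    ultimately show "pcoeff (\<Sum>v\<in>A. w v * ipair v y * cst (ipair v b)) (\<mu> + s) \<noteq> 0"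
      by (metis less_irrefl of_real_eq_0_iff)
  qed
qed

text \<open>By \<open>hessian_lower_bound\<close> the Hessian is injective, hence surjective as an
  endomorphism of a finite-dimensional space over the field of series.\<close>

lemma hessian_surj:
  assumes w: "weights w"
  obtains y :: "puiseux ^ 'n" where "\<And>j. (\<Sum>v\<in>A. w v * ipair v y * of_int (v $ j)) = R $ j"
proof -
  define f :: "puiseux ^ 'n \<Rightarrow> puiseux ^ 'n"
    where "f y = (\<chi> j. \<Sum>v\<in>A. w v * ipair v y * of_int (v $ j))" for y
  have ip_add: "ipair v (y + z) = ipair v y + ipair v z"
    and ip_scale: "ipair v (c *s y) = c * ipair v y" for v and y z :: "puiseux ^ 'n" and c
    by (simp_all add: ipair_def distrib_left sum.distrib sum_distrib_left mult_ac)
  have lin: "Vector_Spaces.linear (*s) (*s) f"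
    by unfold_locales
      (simp_all add: f_def vec_eq_iff ip_add ip_scale algebra_simps sum.distrib sum_distrib_left)
  have "y = 0" if "f y = 0" for y
  proof (rule ccontr)
    assume "y \<noteq> 0"
    then obtain b :: "complex ^ 'n" and s \<mu>
      where "pcoeff (\<Sum>v\<in>A. w v * ipair v y * cst (ipair v b)) (\<mu> + s) \<noteq> 0"
      by (rule hessian_lower_bound[OF w])
    moreover have "(\<Sum>v\<in>A. w v * ipair v y * cst (ipair v b)) = 0"
      unfolding cst_ipair by (rule weighted_sum_ipair) (use that in \<open>simp add: f_def vec_eq_iff\<close>)
    ultimately show False by simp
  qed
  then have "inj f"
    using vec.linear_inj_iff_eq_0[OF lin] by blast
  then have "surj f" using vec.linear_inj_imp_surj[OF lin] by blast
  then obtain y where "f y = R" by (metis surjD)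
  then show ?thesis using that by (auto simp: f_def vec_eq_iff)
qed

lemma newton_step:
  assumes w: "weights w" and res: "residual_ge A D e w" and "e > 0"
  obtains y where "\<And>j. vge (y $ j) e" "residual_ge A D (2 * e) (\<lambda>v. w v * mon (\<chi> j. 1 + y $ j) v)"
proof -
  obtain y :: "puiseux ^ 'n" where
    y: "\<And>j. (\<Sum>v\<in>A. w v * ipair v y * of_int (v $ j)) = (\<chi> j. - (\<Sum>v\<in>A. w v * of_int (v $ j))) $ j"
    using hessian_surj[OF w] by blast
  \<comment> \<open>As \<open>y\<close> solves the linearised equation, the first-order part of the
    new residual vanishes exactly.\<close>
  have eq: "(\<Sum>v\<in>A. w v * (1 + ipair v y) * cst (ipair v b)) = 0" for b
    unfolding cst_ipair
    by (rule weighted_sum_ipair) (use y in \<open>simp add: distrib_left distrib_right sum.distrib\<close>)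
  have ye: "vge (y $ j) e" for j
  proof (cases "y = 0")
    case False
    then obtain b :: "complex ^ 'n" and s \<mu> where ys: "\<And>j. vge (y $ j) s"
      and low: "\<And>v. v \<in> A \<Longrightarrow> D v < \<mu> \<Longrightarrow> ipair v b = 0"
      and nz: "pcoeff (\<Sum>v\<in>A. w v * ipair v y * cst (ipair v b)) (\<mu> + s) \<noteq> 0"
      by (rule hessian_lower_bound[OF w]) blast
    \<comment> \<open>If \<open>s < e\<close>, then \<open>D v + e \<le> \<mu> + s\<close> forces
      \<open>D v < \<mu>\<close>, so \<open>b\<close> annihilates all that the residual may contain
      at \<open>\<mu> + s\<close>. By \<open>eq\<close>, however, this pairing is minus the non-zero
      coefficient of the Hessian form.\<close>
    have "e \<le> s"
    proof (rule ccontr)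
      assume "\<not> e \<le> s"
      then have "(\<Sum>v\<in>A. pcoeff (w v) (\<mu> + s) * ipair v b) = 0"
        using res low unfolding residual_ge_def by force
      then have "pcoeff (\<Sum>v\<in>A. w v * cst (ipair v b)) (\<mu> + s) = 0"
        by (simp only: pcoeff_weighted_sum_cst)
      moreover have "(\<Sum>v\<in>A. w v * ipair v y * cst (ipair v b)) = - (\<Sum>v\<in>A. w v * cst (ipair v b))"
        using eq[of b] by (simp add: algebra_simps sum.distrib eq_neg_iff_add_eq_0)
      ultimately show False using nz by simp
    qed
    then show ?thesis using vge_mono[OF ys] by blast
  qed simp
  define z where "z v = mon (\<chi> j. 1 + y $ j) v - 1 - ipair v y" for v
  have "vge (z v) (2 * e)" for v
    using approx_mon[OF ye \<open>e > 0\<close>, of v] by (simp add: approx_def z_def)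
  then have "residual_ge A D (2 * e) (\<lambda>v. w v * z v)"
    using weights_vge[OF w] by (intro residual_ge_vge vge_mult) auto
  moreover have "residual_ge A D (2 * e) (\<lambda>v. w v * (1 + ipair v y))"
    unfolding residual_ge_def pcoeff_weighted_sum_cst[symmetric] eq by simp
  ultimately have "residual_ge A D (2 * e) (\<lambda>v. w v * z v + w v * (1 + ipair v y))"
    by (rule residual_ge_add)
  moreover have "w v * z v + w v * (1 + ipair v y) = w v * mon (\<chi> j. 1 + y $ j) v" for v
    by (simp add: z_def algebra_simps)
  ultimately show ?thesis using that[OF ye] by simp
qed

lemma residual_ge_mono: "residual_ge A D e x \<Longrightarrow> f \<le> e \<Longrightarrow> residual_ge A D f x"
  unfolding residual_ge_def by (meson add_left_mono order_trans)

lemma newton_limit: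
  assumes w: "weights w" and res: "residual_ge A D \<epsilon> w" and "\<epsilon> > 0"
  obtains q where "\<And>j. q $ j \<in> K_pos" "\<And>j. (\<Sum>v\<in>A. w v * mon q v * of_int (v $ j)) = 0"
proof -
  \<comment> \<open>Each step doubles the order, but the growth \<open>(k + 1) * \<epsilon>\<close>
    is enough and has the form that \<open>puiseux_limit\<close> asks for.\<close>
  define e where "e k = real k * \<epsilon> + \<epsilon>" for k
  have e: "e k > 0" "\<epsilon> \<le> e k" "e (Suc k) \<le> 2 * e k" for k
    using \<open>\<epsilon> > 0\<close> by (auto simp: e_def algebra_simps add_pos_nonneg add_nonneg_pos)
  define P where "P k q \<longleftrightarrow> (\<forall>j. vge (q $ j - 1) \<epsilon>) \<and> residual_ge A D (e k) (\<lambda>v. w v * mon q v)" for k q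
  have "\<exists>q. \<forall>k. P k (q k) \<and> (\<forall>j. vge (q (Suc k) $ j - q k $ j) (e k))"
  proof (rule dependent_nat_choice)
    have "mon 1 v = 1" for v :: "int ^ 'n" by (simp add: mon_def)
    then show "\<exists>q. P 0 q" using res by (intro exI[of _ 1]) (simp add: P_def e_def)
    fix q k assume q: "P k q"
    then have q1: "\<And>j. vge (q $ j - 1) \<epsilon>" and r: "residual_ge A D (e k) (\<lambda>v. w v * mon q v)"
      by (auto simp: P_def)
    have "weights (\<lambda>v. w v * mon q v)" by (rule weights_mult_unit[OF w vge_mon]) (use q1 \<open>\<epsilon> > 0\<close> in auto)
    then obtain y where y: "\<And>j. vge (y $ j) (e k)"
      "residual_ge A D (2 * e k) (\<lambda>v. w v * mon q v * mon (\<chi> j. 1 + y $ j) v)"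
      using newton_step r e(1) by blast
    let ?q = "\<chi> j. q $ j * (1 + y $ j)"
    have mon: "mon ?q v = mon q v * mon (\<chi> j. 1 + y $ j) v" for v
      using mon_mult[of q "\<chi> j. 1 + y $ j"] by simp
    have q0: "vge (q $ j) 0" for j
      using K_posD(2)[OF vge_imp_K_pos(1)[OF q1 \<open>\<epsilon> > 0\<close>]] vge_imp_K_pos(2)[OF q1 \<open>\<epsilon> > 0\<close>] by simp
    have step: "vge (?q $ j - q $ j) (e k)" for j
      using vge_mult[OF q0 y(1)] by (simp add: algebra_simps)
    have "vge (?q $ j - 1) \<epsilon>" for j
      using vge_add[OF vge_mono[OF step e(2)] q1, of j] by (simp add: algebra_simps)
    moreover have "residual_ge A D (e (Suc k)) (\<lambda>v. w v * mon ?q v)"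
      using residual_ge_mono[OF y(2) e(3)] by (simp only: mon mult.assoc)
    ultimately show "\<exists>q'. P (Suc k) q' \<and> (\<forall>j. vge (q' $ j - q $ j) (e k))"
      using step unfolding P_def by blast
  qed
  then obtain q where P: "\<And>k. P k (q k)" and step: "\<And>k j. vge (q (Suc k) $ j - q k $ j) (e k)" by blast
  have "\<exists>l. \<forall>k. vge (l - q k $ j) (e k)" for j
    using puiseux_limit[of "\<lambda>k. q k $ j" \<epsilon> \<epsilon>] step \<open>\<epsilon> > 0\<close> unfolding e_def by metis
  then obtain l where l: "\<And>j k. vge (l j - q k $ j) (e k)" by metis
  define Q where "Q = (\<chi> j. l j)"
  have q1: "vge (q k $ j - 1) \<epsilon>" for k j using P by (auto simp: P_def)
  have Q1: "vge (Q $ j - 1) \<epsilon>" for j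
    using vge_add[OF vge_mono[OF l[of j 0] e(2)] q1[of 0 j]] by (simp add: Q_def)
  note qK = vge_imp_K_pos[OF q1 \<open>\<epsilon> > 0\<close>]
  have res_Q: "residual_ge A D (e k) (\<lambda>v. w v * mon Q v)" for k
  proof -
    \<comment> \<open>The factor from \<open>q k\<close> to the limit. It is \<open>1\<close> up to
      order \<open>e k\<close>, so \<open>Q\<close> inherits the residual bound of
      \<open>q k\<close>.\<close>
    define z where "z = (\<chi> j. Q $ j * inverse (q k $ j))"
    have nz: "q k $ j \<noteq> 0" for j using qK(1) K_posD(1) by blast
    have "vge (z $ j - 1) (e k)" for j
    proof -
      have "vge (inverse (q k $ j)) 0"
        using K_posD(2)[OF K_pos_inverse(1)[OF qK(1)]] K_pos_inverse(2)[OF qK(1)] qK(2) by simp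
      then have "vge ((l j - q k $ j) * inverse (q k $ j)) (e k)" using vge_mult[OF l] by fastforce
      then show ?thesis using nz[of j] by (simp add: z_def Q_def left_diff_distrib)
    qed
    then have z: "vge (mon z v - 1) (e k)" for v by (rule vge_mon) (rule e(1))
    have "Q = (\<chi> j. q k $ j * z $ j)" using nz by (simp add: vec_eq_iff z_def)
    then have mon: "mon Q v = mon (q k) v * mon z v" for v by (metis mon_mult)
    have wk: "weights (\<lambda>v. w v * mon (q k) v)"
      by (rule weights_mult_unit[OF w vge_mon]) (use q1 \<open>\<epsilon> > 0\<close> in auto)
    have "residual_ge A D (e k) (\<lambda>v. w v * mon (q k) v * mon z v)"
      by (rule residual_ge_unit_mult[OF _ weights_vge[OF wk] z]) (use P in \<open>auto simp: P_def\<close>)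
    then show ?thesis by (simp only: mon mult.assoc)
  qed
  show ?thesis
  proof (rule that[of Q])
    show "Q $ j \<in> K_pos" for j by (rule vge_imp_K_pos[OF Q1 \<open>\<epsilon> > 0\<close>])
    show "(\<Sum>v\<in>A. w v * mon Q v * of_int (v $ j)) = 0" for j
    proof (rule residual_ge_eq_0[OF fin _ \<open>\<epsilon> > 0\<close>])
      show "residual_ge A D (real k * \<epsilon>) (\<lambda>v. w v * mon Q v)" for k :: nat
        by (rule residual_ge_mono[OF res_Q[of k]]) (use \<open>\<epsilon> > 0\<close> in \<open>simp add: e_def\<close>)
    qed
  qed
qed

end

section \<open>From leading terms to a critical point\<close>

text \<open>As each \<open>v\<close> is integral, it annihilates the real and imaginary parts of
  \<open>b\<close> separately.\<close>

lemma ipair_complex_eq_0: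
  fixes A :: "(int ^ 'n::finite) set" and b :: "complex ^ 'n"
  assumes "\<And>u :: real ^ 'n. (\<And>v. v \<in> A \<Longrightarrow> ipair v u = 0) \<Longrightarrow> u = 0"
    and "\<And>v. v \<in> A \<Longrightarrow> ipair v b = 0"
  shows "b = 0"
proof -
  have "ipair v (\<chi> j. Re (b $ j)) = Re (ipair v b)" "ipair v (\<chi> j. Im (b $ j)) = Im (ipair v b)" for v
    by (simp_all add: ipair_def)
  then have "(\<chi> j. Re (b $ j)) = 0" "(\<chi> j. Im (b $ j)) = 0"
    using assms(2) by (auto intro!: assms(1))
  then show ?thesis by (simp add: vec_eq_iff complex_eq_iff)
qed

lemma ipair_eq_inner: "ipair v u = (\<chi> j. real_of_int (v $ j)) \<bullet> u"
  by (simp add: ipair_def inner_vec_def)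

lemma positive_critical_point_exists:
  fixes \<gamma> :: "int ^ 'n::finite \<Rightarrow> puiseux"
  assumes "finite A" and \<gamma>: "\<And>v. v \<in> A \<Longrightarrow> \<gamma> v \<in> K_pos"
    and ndeg: "\<forall>u :: real ^ 'n. (\<forall>v\<in>A. ipair v u \<le> 0) \<longrightarrow> u = 0"
  obtains p where "p \<in> torus_pos" "\<And>j. (\<Sum>v\<in>A. \<gamma> v * p v * of_int (v $ j)) = 0"
proof -
  define g where "g v = lc (\<gamma> v)" for v
  define c where "c v = leading_exponent (\<gamma> v)" for v
  have gpos: "g v > 0" if "v \<in> A" for v unfolding g_def by (rule K_posD(4)[OF \<gamma>[OF that]])
  have "\<exists>d a. \<forall>s u. (\<forall>v\<in>A. c v + ipair v d < s \<longrightarrow> ipair v u = 0) \<longrightarrow>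
       (\<Sum>v | v \<in> A \<and> c v + ipair v d = s. g v * exp (ipair v a) * ipair v u) = 0"
    using leading_point_exists[where c = c and g = g, OF assms(1) gpos ndeg[unfolded ipair_eq_inner]]
    unfolding ipair_eq_inner .
  then obtain d a :: "real ^ 'n" where da: "\<And>s u. \<forall>v\<in>A. c v + ipair v d < s \<longrightarrow> ipair v u = 0 \<Longrightarrow>
       (\<Sum>v | v \<in> A \<and> c v + ipair v d = s. g v * exp (ipair v a) * ipair v u) = 0"
    by blast
  \<comment> \<open>The starting point of Newton's method: its coordinates are single terms with
    exponents from \<open>d\<close> and coefficients the exponentials of the entries of
    \<open>a\<close>.\<close>
  define p0 where "p0 v = monomial (of_real (exp (ipair v a))) (ipair v d)" for v
  have ip_add: "ipair (v + w) u = ipair v u + ipair w u" for v w and u :: "real ^ 'n"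
    by (simp add: ipair_def distrib_right sum.distrib)
  have p0: "p0 \<in> torus_pos"
    unfolding torus_pos_def p0_def
    by (auto simp: monomial_mult ip_add exp_add simp del: of_real_exp intro!: K_pos_monomial)
  have p0_lead: "vge (p0 v) (ipair v d)" "pcoeff (p0 v) (ipair v d) = of_real (exp (ipair v a))" for v
    by (auto simp: p0_def vge_def pcoeff_monomial)
  note p0_K = K_posI[OF p0_lead exp_gt_zero]
  define D where "D v = c v + ipair v d" for v
  define w where "w v = \<gamma> v * p0 v" for v
  have ndeg': "b = 0" if "\<And>v. v \<in> A \<Longrightarrow> ipair v b = 0" for b :: "complex ^ 'n"
    by (rule ipair_complex_eq_0[OF _ that]) (simp_all add: ndeg)
  interpret leading_weights A D by unfold_locales (use assms(1) ndeg' in auto)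
  have weights: "weights w"
    unfolding weights_def w_def D_def c_def using K_pos_mult(1,2)[OF \<gamma> p0_K(1)] p0_K(2) by simp
  have lead: "pcoeff (w v) (D v) = of_real (g v * exp (ipair v a))" if "v \<in> A" for v
    using pcoeff_mult_bottom[OF K_posD(2)[OF \<gamma>[OF that]] p0_lead(1)] K_posD(3)[OF \<gamma>[OF that]] p0_lead(2)
    by (simp add: w_def D_def c_def g_def)
  have initial: "\<forall>s (b :: complex ^ 'n). (\<forall>v\<in>A. D v < s \<longrightarrow> ipair v b = 0) \<longrightarrow>
      (\<Sum>v | v \<in> A \<and> D v = s. pcoeff (w v) s * ipair v b) = 0"
  proof (intro allI impI)
    fix s and b :: "complex ^ 'n"
    assume low: "\<forall>v\<in>A. D v < s \<longrightarrow> ipair v b = 0"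
    \<comment> \<open>\<open>da\<close> speaks of real vectors, so it is applied to the real and
      imaginary parts of \<open>b\<close>.\<close>
    let ?S = "\<lambda>u. \<Sum>v | v \<in> A \<and> D v = s. g v * exp (ipair v a) * ipair v u"
    have parts: "Re (ipair v b) = ipair v (\<chi> j. Re (b $ j))" "Im (ipair v b) = ipair v (\<chi> j. Im (b $ j))" for v
      by (simp_all add: ipair_def)
    have "(\<Sum>v | v \<in> A \<and> D v = s. pcoeff (w v) s * ipair v b) =
        (\<Sum>v | v \<in> A \<and> D v = s. of_real (g v * exp (ipair v a)) * ipair v b)"
      using lead by (intro sum.cong refl) auto
    also have "\<dots> = Complex (?S (\<chi> j. Re (b $ j))) (?S (\<chi> j. Im (b $ j)))"
      by (simp add: complex_eq_iff parts del: of_real_mult)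
    also have "?S (\<chi> j. Re (b $ j)) = 0"
      unfolding D_def by (rule da) (use low in \<open>simp add: D_def flip: parts\<close>)
    also have "?S (\<chi> j. Im (b $ j)) = 0"
      unfolding D_def by (rule da) (use low in \<open>simp add: D_def flip: parts\<close>)
    finally show "(\<Sum>v | v \<in> A \<and> D v = s. pcoeff (w v) s * ipair v b) = 0" by (simp add: complex_eq_iff)
  qed
  obtain \<epsilon> where "\<epsilon> > 0" "residual_ge A D \<epsilon> w"
    using residual_ge_initial[OF assms(1) weights_vge[OF weights] initial] by blast
  then obtain q where q: "\<And>j. q $ j \<in> K_pos" "\<And>j. (\<Sum>v\<in>A. w v * mon q v * of_int (v $ j)) = 0"
    using newton_limit[OF weights] by blast
  show ?thesis
  proof
    show "(\<lambda>v. p0 v * mon q v) \<in> torus_pos" using torus_pos_mult[OF p0 mon_torus_pos[OF q(1)]] .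
    show "(\<Sum>v\<in>A. \<gamma> v * (p0 v * mon q v) * of_int (v $ j)) = 0" for j
      using q(2)[of j] by (simp only: w_def mult.assoc)
  qed
qed


section \<open>The Newton polytope\<close>

text \<open>A small negative multiple of \<open>u\<close> lies in the hull and violates the
  half-space condition. Conversely, if \<open>0\<close> is not interior, it is separated from the
  interior, and the closure extends this to the hull; a hull with empty interior lies in a
  hyperplane, whose normal serves up to sign.\<close>

lemma zero_in_interior_hull_iff:
  fixes S :: "'a::euclidean_space set"
  assumes "finite S"
  shows "0 \<in> interior (convex hull S) \<longleftrightarrow> (\<forall>u. (\<forall>x\<in>S. 0 \<le> u \<bullet> x) \<longrightarrow> u = 0)"
proof
  assume "0 \<in> interior (convex hull S)"
  then obtain e where e: "e > 0" "ball 0 e \<subseteq> convex hull S"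
    using mem_interior by blast
  show "\<forall>u. (\<forall>x\<in>S. 0 \<le> u \<bullet> x) \<longrightarrow> u = 0"
  proof (intro allI impI, rule ccontr)
    fix u assume u: "\<forall>x\<in>S. 0 \<le> u \<bullet> x" "u \<noteq> 0"
    have "convex hull S \<subseteq> {x. u \<bullet> x \<ge> 0}"
      using u(1) by (intro hull_minimal convex_halfspace_ge) auto
    moreover have "- (e / (2 * norm u)) *\<^sub>R u \<in> ball 0 e" using e(1) u(2) by simp
    ultimately have "u \<bullet> (- (e / (2 * norm u)) *\<^sub>R u) \<ge> 0" using e(2) by blast
    then have "u \<bullet> u \<le> 0" using e(1) u(2) by (simp add: divide_le_0_iff mult_le_0_iff)
    then show False using u(2) by (metis inner_gt_zero_iff not_le)
  qed
next
  assume *: "\<forall>u. (\<forall>x\<in>S. 0 \<le> u \<bullet> x) \<longrightarrow> u = 0"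
  show "0 \<in> interior (convex hull S)"
  proof (rule ccontr)
    assume notin: "0 \<notin> interior (convex hull S)"
    have "\<exists>a. a \<noteq> 0 \<and> (\<forall>x\<in>convex hull S. 0 \<le> a \<bullet> x)"
    proof (cases "interior (convex hull S) = {}")
      case True
      then obtain a b where ab: "a \<noteq> 0" "convex hull S \<subseteq> {x. a \<bullet> x = b}"
        using empty_interior_subset_hyperplane[of "convex hull S"] by auto
      show ?thesis
        \<comment> \<open>The sign of \<open>b\<close> decides between \<open>a\<close> and
          \<open>- a\<close>.\<close>
        by (cases "b \<ge> 0") (use ab in \<open>force intro: exI[of _ a]\<close>, use ab in \<open>force intro: exI[of _ "- a"]\<close>)
    next
      case False
      obtain a where a: "a \<noteq> 0" "\<forall>x\<in>interior (convex hull S). 0 \<le> a \<bullet> x"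
        using separating_hyperplane_set_0[OF convex_interior notin] by auto
      then have "closure (interior (convex hull S)) \<subseteq> {x. a \<bullet> x \<ge> 0}"
        by (intro closure_minimal closed_halfspace_ge) auto
      then show ?thesis
        using a(1) convex_closure_interior[OF _ False] closure_subset[of "convex hull S"] by auto
    qed
    then show False using * hull_subset[of S convex] by blast
  qed
qed

lemma newton_polytope_interior_iff:
  "0 \<in> interior (newton_polytope W) \<longleftrightarrow>
    (\<forall>u :: real ^ 'n::finite. (\<forall>v\<in>Poly_Mapping.keys W. 0 \<le> ipair v u) \<longrightarrow> u = 0)"
  unfolding newton_polytope_def ipair_eq_inner
  by (subst zero_in_interior_hull_iff) (simp_all add: inner_commute)

theorem corollary8p5:
  fixes W :: "'r::finite laurent"
    and n :: nat and \<gamma> :: "nat \<Rightarrow> puiseux" and v :: "nat \<Rightarrow> int ^ 'r"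
  assumes "\<And>i. i \<in> {1..n} \<Longrightarrow> \<gamma> i \<in> K_pos"
    and "inj_on v {1..n}"
    and "W = (\<Sum>i = 1..n. Poly_Mapping.single (v i) (\<gamma> i))"
  shows "(\<exists>!p. p \<in> torus_pos \<and> critical_point W p) \<longleftrightarrow>
    aff_dim (newton_polytope W) = int CARD('r) \<and> 0 \<in> interior (newton_polytope W)"
proof -
  let ?A = "Poly_Mapping.keys W" and ?\<Gamma> = "Poly_Mapping.lookup W"
  have lookup: "?\<Gamma> x = (\<Sum>i = 1..n. if v i = x then \<gamma> i else 0)" for x
    by (simp add: assms(3) lookup_sum lookup_single when_def)
  \<comment> \<open>By injectivity of \<open>v\<close> no two terms merge, so each non-zero
    coefficient of \<open>W\<close> is one of the \<open>\<gamma> i\<close>.\<close>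
  have pos: "?\<Gamma> x \<in> K_pos" if "x \<in> ?A" for x
  proof -
    have "?\<Gamma> x \<noteq> 0" using that by (simp add: in_keys_iff)
    then obtain k where "k \<in> {1..n}" "(if v k = x then \<gamma> k else 0) \<noteq> 0"
      unfolding lookup by (rule sum.not_neutral_contains_not_neutral)
    then have k: "k \<in> {1..n}" "v k = x" by (auto split: if_splits)
    then have "?\<Gamma> x = (\<Sum>i = 1..n. if i = k then \<gamma> i else 0)"
      unfolding lookup using inj_onD[OF assms(2)] by (intro sum.cong refl) auto
    also have "\<dots> = \<gamma> k" using k by simp
    finally show ?thesis using assms(1) k by simp
  qed
  have "(\<exists>!p. p \<in> torus_pos \<and> critical_point W p) \<longleftrightarrow> 0 \<in> interior (newton_polytope W)"
    unfolding newton_polytope_interior_iff critical_point_iff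
  proof (intro iffI allI impI)
    fix u :: "real ^ 'r"
    assume ex1: "\<exists>!p. p \<in> torus_pos \<and> (\<forall>j. (\<Sum>x\<in>?A. ?\<Gamma> x * p x * of_int (x $ j)) = 0)"
      and u: "\<forall>x\<in>?A. 0 \<le> ipair x u"
    show "u = 0"
    proof (rule ccontr)
      assume "u \<noteq> 0"
      obtain p where p: "p \<in> torus_pos" "\<And>j. (\<Sum>x\<in>?A. ?\<Gamma> x * p x * of_int (x $ j)) = 0"
        using ex1 by blast
      obtain p' where "p' \<in> torus_pos" "\<And>j. (\<Sum>x\<in>?A. ?\<Gamma> x * p' x * of_int (x $ j)) = 0" "p' \<noteq> p"
        using positive_critical_point_not_unique[where \<gamma> = ?\<Gamma>, OF finite_keys pos \<open>u \<noteq> 0\<close> _ p] u by blast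
      then show False using ex1 p by blast
    qed
  next
    assume *: "\<forall>u :: real ^ 'r. (\<forall>x\<in>?A. 0 \<le> ipair x u) \<longrightarrow> u = 0"
    \<comment> \<open>Passing to \<open>- u\<close> adapts the sign convention of the interior
      criterion to that of the minimisation.\<close>
    have ndeg: "\<forall>u :: real ^ 'r. (\<forall>x\<in>?A. ipair x u \<le> 0) \<longrightarrow> u = 0"
    proof (intro allI impI)
      fix u :: "real ^ 'r" assume "\<forall>x\<in>?A. ipair x u \<le> 0"
      then show "u = 0" using *[rule_format, of "- u"] by (simp add: ipair_minus)
    qed
    obtain p where p: "p \<in> torus_pos" "\<And>j. (\<Sum>x\<in>?A. ?\<Gamma> x * p x * of_int (x $ j)) = 0"
      using positive_critical_point_exists[where \<gamma> = ?\<Gamma>, OF finite_keys pos ndeg] by blast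
    have ndeg': "b = 0" if "\<And>x. x \<in> ?A \<Longrightarrow> ipair x b = 0" for b :: "complex ^ 'r"
      by (rule ipair_complex_eq_0[OF _ that]) (simp_all add: ndeg)
    show "\<exists>!p. p \<in> torus_pos \<and> (\<forall>j. (\<Sum>x\<in>?A. ?\<Gamma> x * p x * of_int (x $ j)) = 0)"
    proof (rule ex1I[of _ p])
      show "p' = p" if "p' \<in> torus_pos \<and> (\<forall>j. (\<Sum>x\<in>?A. ?\<Gamma> x * p' x * of_int (x $ j)) = 0)" for p'
        by (rule positive_critical_point_unique[where \<gamma> = ?\<Gamma>, OF finite_keys pos ndeg' p]) (use that in auto)
    qed (use p in blast)
  qed
  \<comment> \<open>A set with an interior point has the affine dimension of the ambient
    space.\<close>
  moreover have "aff_dim (newton_polytope W) = int CARD('r)" if "0 \<in> interior (newton_polytope W)"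
    using aff_dim_nonempty_interior[of "newton_polytope W"] that by auto
  ultimately show ?thesis by blast
qed

end
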